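(* Let $k$ be a field of characteristic zero, let $p,q,r\ge 2$ be integers, and let $A=k[x,y,z]/(x^p+y^q+z^r-1)$ with module of Kähler differentials $\Omega=\Omega^1_{A/k}$. The operators $\nabla(\partial_i):\Omega\to\Omega$ induced by $D_{\partial_i}+\partial_i(M):A^3\to A^3$, $i=1,2,3$, define an (algebraic) connection $$\nabla:\operatorname{Der}_k(A)\to\operatorname{End}_k(\Omega).$$ That is, there is an $A$-linear map $\nabla:\operatorname{Der}_k(A)\to\operatorname{End}_k(\Omega)$ with $\nabla(\delta)(a\omega)=a\nabla(\delta)(\omega)+\delta(a)\omega$ for all $\delta\in\operatorname{Der}_k(A)$, $a\in A$, $\omega\in\Omega$, whose values at the generators $\partial_1,\partial_2,\partial_3$ are these operators.
   Context: Let $f=x^p+y^q+z^r-1$. Identify $\Omega=A\{u_1,u_2,u_3\}/A\,dF$, where $dF=px^{p-1}u_1+qy^{q-1}u_2+rz^{r-1}u_3$ and $u_1,u_2,u_3$ (a free basis of $A^3$) map to $dx,dy,dz$. The $A$-module $\operatorname{Der}_k(A)$ is generated by $\partial_1=qy^{q-1}\partial_x-px^{p-1}\partial_y$, $\partial_2=rz^{r-1}\partial_x-px^{p-1}\partial_z$, $\partial_3=rz^{r-1}\partial_y-qy^{q-1}\partial_z$. Let $$M=\begin{pmatrix}1-x^p&-\frac pq x^{p-1}y&-\frac pr x^{p-1}z\\ -\frac qp xy^{q-1}&1-y^q&-\frac qr y^{q-1}z\\ -\frac rp xz^{r-1}&-\frac rq yz^{r-1}&1-z^r\end{pmatrix},$$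 acting on $A^3$ (column vectors in the basis $u_1,u_2,u_3$). For $\delta\in\operatorname{Der}_k(A)$ let $D_\delta(\sum a_iu_i)=\sum\delta(a_i)u_i$ and let $\delta(M)$ be the matrix obtained by applying $\delta$ to the entries of $M$. An operator on $A^3$ induces an operator on $\Omega$ if it maps $A\,dF$ into itself. *)

theory Defs
  imports
    "HOL-Algebra.Algebraic_Closure_Type"
    "HOL-Algebra.QuotRing"
    "HOL-Algebra.Module"
    "HOL-Library.FuncSet"
begin

section \<open>Modules over a commutative ring\<close>

text \<open>
  The record type for modules extends the one for rings; its fields \<open>mult\<close> and \<open>one\<close> play no role
  in the theory of modules and are left unspecified below.
\<close>

definition free_module :: "'a ring \<Rightarrow> 'i set \<Rightarrow> ('a, 'i \<Rightarrow> 'a) module" where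
  "free_module A S =
     \<lparr>carrier = {v \<in> S \<rightarrow>\<^sub>E carrier A. finite {s \<in> S. v s \<noteq> \<zero>\<^bsub>A\<^esub>}},
      monoid.mult = undefined, one = undefined,
      ring.zero = (\<lambda>s\<in>S. \<zero>\<^bsub>A\<^esub>),
      add = (\<lambda>v w. \<lambda>s\<in>S. v s \<oplus>\<^bsub>A\<^esub> w s),
      module.smult = (\<lambda>a v. \<lambda>s\<in>S. a \<otimes>\<^bsub>A\<^esub> v s)\<rparr>"

definition free_gen :: "'a ring \<Rightarrow> 'i set \<Rightarrow> 'i \<Rightarrow> ('i \<Rightarrow> 'a)" where
  "free_gen A S t = (\<lambda>s\<in>S. if s = t then \<one>\<^bsub>A\<^esub> else \<zero>\<^bsub>A\<^esub>)"

definition submodule_gen :: "'a ring \<Rightarrow> ('a, 'm) module \<Rightarrow> 'm set \<Rightarrow> 'm set" where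
  "submodule_gen A M S = \<Inter>{N. submodule N A M \<and> S \<subseteq> N}"

text \<open>The additive part is as for \<open>(Quot)\<close>, to whose multiplication the union below is analogous.\<close>

definition quot_module :: "('a, 'm) module \<Rightarrow> 'm set \<Rightarrow> ('a, 'm set) module" where
  "quot_module M N =
     \<lparr>carrier = a_rcosets\<^bsub>M\<^esub> N,
      monoid.mult = undefined, one = undefined,
      ring.zero = N,
      add = set_add M,
      module.smult = (\<lambda>a C. \<Union>x\<in>C. N +>\<^bsub>M\<^esub> (a \<odot>\<^bsub>M\<^esub> x))\<rparr>"

definition linear_maps :: "'a ring \<Rightarrow> ('a, 'm) module \<Rightarrow> ('a, 'n) module \<Rightarrow> ('m \<Rightarrow> 'n) set" where
  "linear_maps A M N =
     {T \<in> carrier M \<rightarrow>\<^sub>E carrier N.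
        (\<forall>v\<in>carrier M. \<forall>w\<in>carrier M. T (v \<oplus>\<^bsub>M\<^esub> w) = T v \<oplus>\<^bsub>N\<^esub> T w) \<and>
        (\<forall>a\<in>carrier A. \<forall>v\<in>carrier M. T (a \<odot>\<^bsub>M\<^esub> v) = a \<odot>\<^bsub>N\<^esub> T v)}"


section \<open>Derivations, differentials and connections\<close>

text \<open>
  Below, \<open>A\<close> is a commutative algebra over a field that embeds into \<open>A\<close>, and \<open>K \<subseteq> carrier A\<close> is the
  image of that field. Maps are extensional functions, so that equal maps are equal in HOL.
\<close>

definition Der :: "'a set \<Rightarrow> 'a ring \<Rightarrow> ('a, 'a \<Rightarrow> 'a) module" where
  "Der K A =
     \<lparr>carrier = {\<delta> \<in> carrier A \<rightarrow>\<^sub>E carrier A.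
        (\<forall>a\<in>carrier A. \<forall>b\<in>carrier A. \<delta> (a \<oplus>\<^bsub>A\<^esub> b) = \<delta> a \<oplus>\<^bsub>A\<^esub> \<delta> b) \<and>
        (\<forall>c\<in>K. \<forall>a\<in>carrier A. \<delta> (c \<otimes>\<^bsub>A\<^esub> a) = c \<otimes>\<^bsub>A\<^esub> \<delta> a) \<and>
        (\<forall>a\<in>carrier A. \<forall>b\<in>carrier A.
           \<delta> (a \<otimes>\<^bsub>A\<^esub> b) = a \<otimes>\<^bsub>A\<^esub> \<delta> b \<oplus>\<^bsub>A\<^esub> b \<otimes>\<^bsub>A\<^esub> \<delta> a)},
      monoid.mult = undefined, one = undefined,
      ring.zero = (\<lambda>a\<in>carrier A. \<zero>\<^bsub>A\<^esub>),
      add = (\<lambda>\<delta> \<epsilon>. \<lambda>a\<in>carrier A. \<delta> a \<oplus>\<^bsub>A\<^esub> \<epsilon> a),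
      module.smult = (\<lambda>b \<delta>. \<lambda>a\<in>carrier A. b \<otimes>\<^bsub>A\<^esub> \<delta> a)\<rparr>"

text \<open>The \<open>K\<close>-linear endomorphisms of an \<open>A\<close>-module \<open>W\<close>, with \<open>A\<close> acting on the values.\<close>

definition Endo :: "'a set \<Rightarrow> 'a ring \<Rightarrow> ('a, 'm) module \<Rightarrow> ('a, 'm \<Rightarrow> 'm) module" where
  "Endo K A W =
     \<lparr>carrier = linear_maps (A\<lparr>carrier := K\<rparr>) W W,
      monoid.mult = undefined, one = undefined,
      ring.zero = (\<lambda>w\<in>carrier W. \<zero>\<^bsub>W\<^esub>),
      add = (\<lambda>S T. \<lambda>w\<in>carrier W. S w \<oplus>\<^bsub>W\<^esub> T w),
      module.smult = (\<lambda>a T. \<lambda>w\<in>carrier W. a \<odot>\<^bsub>W\<^esub> T w)\<rparr>"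

definition connections ::
    "'a set \<Rightarrow> 'a ring \<Rightarrow> ('a, 'm) module \<Rightarrow> (('a \<Rightarrow> 'a) \<Rightarrow> ('m \<Rightarrow> 'm)) set" where
  "connections K A W =
     {nabla \<in> linear_maps A (Der K A) (Endo K A W).
        \<forall>\<delta>\<in>carrier (Der K A). \<forall>a\<in>carrier A. \<forall>w\<in>carrier W.
          nabla \<delta> (a \<odot>\<^bsub>W\<^esub> w) = a \<odot>\<^bsub>W\<^esub> nabla \<delta> w \<oplus>\<^bsub>W\<^esub> \<delta> a \<odot>\<^bsub>W\<^esub> w}"

text \<open>
  The module of Kaehler differentials: the free \<open>A\<close>-module on symbols \<open>da\<close>, for \<open>a\<close> in \<open>A\<close>, modulo
  \<open>d(a + b) = da + db\<close>, \<open>d(ab) = a db + b da\<close>, and \<open>dc = 0\<close> for \<open>c\<close> in \<open>K\<close>.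
\<close>

definition kaehler_relations :: "'a set \<Rightarrow> 'a ring \<Rightarrow> ('a \<Rightarrow> 'a) set" where
  "kaehler_relations K A =
     (let F = free_module A (carrier A); e = free_gen A (carrier A) in
       {e (a \<oplus>\<^bsub>A\<^esub> b) \<ominus>\<^bsub>F\<^esub> (e a \<oplus>\<^bsub>F\<^esub> e b) | a b. a \<in> carrier A \<and> b \<in> carrier A} \<union>
       {e (a \<otimes>\<^bsub>A\<^esub> b) \<ominus>\<^bsub>F\<^esub> (a \<odot>\<^bsub>F\<^esub> e b \<oplus>\<^bsub>F\<^esub> b \<odot>\<^bsub>F\<^esub> e a) | a b. a \<in> carrier A \<and> b \<in> carrier A} \<union>
       {e c | c. c \<in> K})"

definition kaehler :: "'a set \<Rightarrow> 'a ring \<Rightarrow> ('a, ('a \<Rightarrow> 'a) set) module" where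
  "kaehler K A =
     quot_module (free_module A (carrier A))
       (submodule_gen A (free_module A (carrier A)) (kaehler_relations K A))"

definition kaehler_d :: "'a set \<Rightarrow> 'a ring \<Rightarrow> 'a \<Rightarrow> ('a \<Rightarrow> 'a) set" where
  "kaehler_d K A a =
     submodule_gen A (free_module A (carrier A)) (kaehler_relations K A)
       +>\<^bsub>free_module A (carrier A)\<^esub> free_gen A (carrier A) a"


section \<open>The coordinate ring of the surface\<close>

text \<open>
  \<open>k[x,y,z]\<close> is \<open>k[x][y][z]\<close>: the innermost variable is \<open>x\<close> and the outermost one is \<open>z\<close>.
\<close>

type_synonym 'k poly3 = "'k poly poly poly"

definition const3 :: "'k::field_char_0 \<Rightarrow> 'k poly3" where "const3 c = [:[:[:c:]:]:]"
definition var_x :: "'k::field_char_0 poly3" where "var_x = [:[:[:0, 1:]:]:]"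
definition var_y :: "'k::field_char_0 poly3" where "var_y = [:[:0, 1:]:]"
definition var_z :: "'k::field_char_0 poly3" where "var_z = [:0, 1:]"

definition partial_x :: "'k::field_char_0 poly3 \<Rightarrow> 'k poly3" where
  "partial_x = map_poly (map_poly pderiv)"
definition partial_y :: "'k::field_char_0 poly3 \<Rightarrow> 'k poly3" where
  "partial_y = map_poly pderiv"
definition partial_z :: "'k::field_char_0 poly3 \<Rightarrow> 'k poly3" where
  "partial_z = pderiv"

definition f_poly :: "nat \<Rightarrow> nat \<Rightarrow> nat \<Rightarrow> 'k::field_char_0 poly3" where
  "f_poly p q r = var_x ^ p + var_y ^ q + var_z ^ r - 1"

definition f_ideal :: "nat \<Rightarrow> nat \<Rightarrow> nat \<Rightarrow> 'k::field_char_0 poly3 set" where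
  "f_ideal p q r = PIdl\<^bsub>ring_of_type_algebra\<^esub> (f_poly p q r)"

definition coord_ring :: "nat \<Rightarrow> nat \<Rightarrow> nat \<Rightarrow> 'k::field_char_0 poly3 set ring" where
  "coord_ring p q r = ring_of_type_algebra Quot f_ideal p q r"

definition cls :: "nat \<Rightarrow> nat \<Rightarrow> nat \<Rightarrow> 'k::field_char_0 poly3 \<Rightarrow> 'k poly3 set" where
  "cls p q r g = f_ideal p q r +>\<^bsub>ring_of_type_algebra\<^esub> g"

definition scalars :: "nat \<Rightarrow> nat \<Rightarrow> nat \<Rightarrow> 'k::field_char_0 poly3 set set" where
  "scalars p q r = range (\<lambda>c. cls p q r (const3 c))"

text \<open>
  The map that an operator \<open>D\<close> on \<open>k[x,y,z]\<close> induces on the coordinate ring; the union is over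
  representatives, all of which give the same class if \<open>D\<close> respects congruence modulo \<open>f\<close>
  (as for the vector fields below, by \<open>descend_partial\<close>).
\<close>

definition descend ::
    "nat \<Rightarrow> nat \<Rightarrow> nat \<Rightarrow> ('k::field_char_0 poly3 \<Rightarrow> 'k poly3) \<Rightarrow> 'k poly3 set \<Rightarrow> 'k poly3 set" where
  "descend p q r D = (\<lambda>a\<in>carrier (coord_ring p q r). \<Union>g\<in>a. cls p q r (D g))"

lemma mem_f_ideal: "h \<in> f_ideal p q r \<longleftrightarrow> f_poly p q r dvd h"
  unfolding f_ideal_def cgenideal_def ring_of_type_algebra_def dvd_def
  by (simp add: mult.commute)

lemma mem_cls: "h \<in> cls p q r g \<longleftrightarrow> f_poly p q r dvd h - g"
proof -
  have "h \<in> cls p q r g \<longleftrightarrow> (\<exists>i\<in>f_ideal p q r. h = i + g)"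
    unfolding cls_def a_r_coset_def' by (simp add: ring_of_type_algebra_def)
  also have "\<dots> \<longleftrightarrow> h - g \<in> f_ideal p q r"
    by (metis add_diff_cancel_right' diff_add_cancel)
  finally show ?thesis by (simp only: mem_f_ideal)
qed

lemma cls_eq_iff: "cls p q r g = cls p q r h \<longleftrightarrow> f_poly p q r dvd g - h"
proof
  assume "cls p q r g = cls p q r h"
  moreover have "g \<in> cls p q r g" by (simp only: mem_cls diff_self dvd_0_right)
  ultimately show "f_poly p q r dvd g - h" by (simp add: mem_cls)
next
  assume *: "f_poly p q r dvd g - h"
  have "f_poly p q r dvd u - g \<longleftrightarrow> f_poly p q r dvd u - h" for u
    using dvd_add_left_iff[OF *, of "u - g"] by simp
  then show "cls p q r g = cls p q r h" by (simp only: set_eq_iff mem_cls simp_thms)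
qed

lemma cls_in_carrier: "cls p q r g \<in> carrier (coord_ring p q r)"
proof -
  have "g \<in> carrier ring_of_type_algebra" by (simp add: ring_of_type_algebra_def)
  then show ?thesis
    unfolding coord_ring_def cls_def FactRing_def A_RCOSETS_def' a_r_coset_def'
    by (simp only: partial_object.simps) (rule UN_I, assumption, rule singletonI)
qed

lemma descend_cls:
  assumes "\<And>g h. f_poly p q r dvd g - h \<Longrightarrow> f_poly p q r dvd D g - D h"
  shows "descend p q r D (cls p q r g) = cls p q r (D g)"
proof -
  have "cls p q r (D h) = cls p q r (D g)" if "h \<in> cls p q r g" for h
    unfolding cls_eq_iff by (rule assms) (rule that[unfolded mem_cls])
  moreover have "g \<in> cls p q r g" by (simp only: mem_cls diff_self dvd_0_right)
  ultimately have "(\<Union>h\<in>cls p q r g. cls p q r (D h)) = cls p q r (D g)"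
    by (metis (no_types, lifting) SUP_eq_const empty_iff)
  then show ?thesis
    unfolding descend_def by (simp only: restrict_apply cls_in_carrier if_True)
qed

definition partial_1 :: "nat \<Rightarrow> nat \<Rightarrow> 'k::field_char_0 poly3 \<Rightarrow> 'k poly3" where
  "partial_1 p q g = of_nat q * var_y ^ (q - 1) * partial_x g - of_nat p * var_x ^ (p - 1) * partial_y g"
definition partial_2 :: "nat \<Rightarrow> nat \<Rightarrow> 'k::field_char_0 poly3 \<Rightarrow> 'k poly3" where
  "partial_2 p r g = of_nat r * var_z ^ (r - 1) * partial_x g - of_nat p * var_x ^ (p - 1) * partial_z g"
definition partial_3 :: "nat \<Rightarrow> nat \<Rightarrow> 'k::field_char_0 poly3 \<Rightarrow> 'k poly3" where
  "partial_3 q r g = of_nat r * var_z ^ (r - 1) * partial_y g - of_nat q * var_y ^ (q - 1) * partial_z g"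

lemma map_poly_derivation:
  fixes d :: "'a::comm_ring_1 \<Rightarrow> 'a"
  assumes add: "\<And>a b. d (a + b) = d a + d b"
    and mult: "\<And>a b. d (a * b) = a * d b + b * d a"
  shows "map_poly d (u + v) = map_poly d u + map_poly d v"
    and "map_poly d (u * v) = u * map_poly d v + v * map_poly d u"
proof -
  have d0: "d 0 = 0" using add[of 0 0] by simp
  have dsum: "d (sum h S) = (\<Sum>s\<in>S. d (h s))" for h :: "nat \<Rightarrow> 'a" and S
    by (induction S rule: infinite_finite_induct) (simp_all add: d0 add)
  show "map_poly d (u + v) = map_poly d u + map_poly d v"
    by (rule poly_eqI) (simp add: coeff_map_poly d0 add)
  show "map_poly d (u * v) = u * map_poly d v + v * map_poly d u"
  proof (rule poly_eqI)
    fix n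
    have "coeff (map_poly d (u * v)) n =
        (\<Sum>i\<le>n. coeff u i * d (coeff v (n - i)) + d (coeff u i) * coeff v (n - i))"
      by (simp add: coeff_map_poly d0 coeff_mult dsum mult mult.commute)
    also have "\<dots> = coeff (u * map_poly d v) n + coeff (map_poly d u * v) n"
      by (simp add: coeff_mult coeff_map_poly d0 sum.distrib)
    finally show "coeff (map_poly d (u * v)) n = coeff (u * map_poly d v + v * map_poly d u) n"
      by (simp add: mult.commute)
  qed
qed

lemma partial_add:
  "partial_x (u + v) = partial_x u + partial_x v"
  "partial_y (u + v) = partial_y u + partial_y v"
  "partial_z (u + v) = partial_z u + partial_z v"
  unfolding partial_x_def partial_y_def partial_z_def
  by (intro map_poly_derivation pderiv_add pderiv_mult)+

lemma partial_mult:
  "partial_x (u * v) = u * partial_x v + v * partial_x u"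
  "partial_y (u * v) = u * partial_y v + v * partial_y u"
  "partial_z (u * v) = u * partial_z v + v * partial_z u"
  unfolding partial_x_def partial_y_def partial_z_def
  by (intro map_poly_derivation pderiv_add pderiv_mult)+

lemma derivation_power:
  fixes d :: "'a::comm_ring_1 \<Rightarrow> 'a"
  assumes mult: "\<And>a b. d (a * b) = a * d b + b * d a"
  shows "d (u ^ n) = of_nat n * u ^ (n - 1) * d u"
proof (induction n)
  case 0
  show ?case using mult[of 1 1] by simp
next
  case (Suc n)
  then show ?case
    by (cases n) (simp_all add: mult algebra_simps)
qed

lemma partial_vars:
  "partial_x var_x = 1" "partial_x var_y = 0" "partial_x var_z = 0" "partial_x 1 = 0"
  "partial_y var_x = 0" "partial_y var_y = 1" "partial_y var_z = 0" "partial_y 1 = 0"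
  "partial_z var_x = 0" "partial_z var_y = 0" "partial_z var_z = 1" "partial_z 1 = 0"
  by (simp_all add: partial_x_def partial_y_def partial_z_def var_x_def var_y_def var_z_def
      map_poly_pCons pderiv_pCons one_pCons)

lemma partial_f_poly:
  "partial_x (f_poly p q r) = of_nat p * var_x ^ (p - 1)"
  "partial_y (f_poly p q r) = of_nat q * var_y ^ (q - 1)"
  "partial_z (f_poly p q r) = of_nat r * var_z ^ (r - 1)"
proof -
  have f: "f_poly p q r + 1 = var_x ^ p + var_y ^ q + var_z ^ r" by (simp add: f_poly_def)
  note power = derivation_power[of partial_x, OF partial_mult(1)]
    derivation_power[of partial_y, OF partial_mult(2)]
    derivation_power[of partial_z, OF partial_mult(3)]
  show "partial_x (f_poly p q r) = of_nat p * var_x ^ (p - 1)"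
    using arg_cong[OF f, of partial_x] by (simp add: partial_add power partial_vars)
  show "partial_y (f_poly p q r) = of_nat q * var_y ^ (q - 1)"
    using arg_cong[OF f, of partial_y] by (simp add: partial_add power partial_vars)
  show "partial_z (f_poly p q r) = of_nat r * var_z ^ (r - 1)"
    using arg_cong[OF f, of partial_z] by (simp add: partial_add power partial_vars)
qed

lemma descend_partial:
  "descend p q r (partial_1 p q) (cls p q r g) = cls p q r (partial_1 p q g)"
  "descend p q r (partial_2 p r) (cls p q r g) = cls p q r (partial_2 p r g)"
  "descend p q r (partial_3 q r) (cls p q r g) = cls p q r (partial_3 q r g)"
proof -
  have *: "descend p q r D (cls p q r g) = cls p q r (D g)"
    if add: "\<And>u v. D (u + v) = D u + D v" and mult: "\<And>u v. D (u * v) = u * D v + v * D u"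
      and zero: "D (f_poly p q r) = 0" for D
  proof (rule descend_cls)
    fix g h :: "'a poly3"
    assume "f_poly p q r dvd g - h"
    then obtain m where "g = h + f_poly p q r * m"
      by (metis add_diff_cancel_left' add.commute diff_add_cancel dvdE)
    then have "D g - D h = f_poly p q r * D m"
      by (simp add: add mult zero)
    then show "f_poly p q r dvd D g - D h" by simp
  qed
  show "descend p q r (partial_1 p q) (cls p q r g) = cls p q r (partial_1 p q g)"
    by (rule *) (simp_all add: partial_1_def partial_add partial_mult partial_f_poly algebra_simps)
  show "descend p q r (partial_2 p r) (cls p q r g) = cls p q r (partial_2 p r g)"
    by (rule *) (simp_all add: partial_2_def partial_add partial_mult partial_f_poly algebra_simps)
  show "descend p q r (partial_3 q r) (cls p q r g) = cls p q r (partial_3 q r g)"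
    by (rule *) (simp_all add: partial_3_def partial_add partial_mult partial_f_poly algebra_simps)
qed

definition der_gens :: "nat \<Rightarrow> nat \<Rightarrow> nat \<Rightarrow> ('k::field_char_0 poly3 set \<Rightarrow> 'k poly3 set) set" where
  "der_gens p q r =
     {descend p q r (partial_1 p q), descend p q r (partial_2 p r), descend p q r (partial_3 q r)}"


section \<open>The presentation of the differentials and the operators\<close>

text \<open>\<open>A\<^sup>3\<close> is the free module on the indices \<open>0, 1, 2\<close>, which stand for \<open>u\<^sub>1, u\<^sub>2, u\<^sub>3\<close>.\<close>

definition A3 :: "nat \<Rightarrow> nat \<Rightarrow> nat \<Rightarrow> ('k::field_char_0 poly3 set, nat \<Rightarrow> 'k poly3 set) module" where
  "A3 p q r = free_module (coord_ring p q r) {0, 1, 2}"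

definition dF :: "nat \<Rightarrow> nat \<Rightarrow> nat \<Rightarrow> nat \<Rightarrow> 'k::field_char_0 poly3 set" where
  "dF p q r = (\<lambda>j\<in>{0, 1, 2}. cls p q r
     ([of_nat p * var_x ^ (p - 1), of_nat q * var_y ^ (q - 1), of_nat r * var_z ^ (r - 1)] ! j))"

definition A_dF :: "nat \<Rightarrow> nat \<Rightarrow> nat \<Rightarrow> (nat \<Rightarrow> 'k::field_char_0 poly3 set) set" where
  "A_dF p q r = {a \<odot>\<^bsub>A3 p q r\<^esub> dF p q r | a. a \<in> carrier (coord_ring p q r)}"

text \<open>The map \<open>A\<^sup>3 \<rightarrow> \<Omega>\<close> that sends \<open>u\<^sub>1, u\<^sub>2, u\<^sub>3\<close> to \<open>dx, dy, dz\<close>.\<close>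

definition to_Omega ::
    "nat \<Rightarrow> nat \<Rightarrow> nat \<Rightarrow> (nat \<Rightarrow> 'k::field_char_0 poly3 set) \<Rightarrow> ('k poly3 set \<Rightarrow> 'k poly3 set) set" where
  "to_Omega p q r v =
     (let A = coord_ring p q r; K = scalars p q r; \<Omega> = kaehler K A in
       \<Oplus>\<^bsub>\<Omega>\<^esub>j\<in>{0, 1, 2}. v j \<odot>\<^bsub>\<Omega>\<^esub> kaehler_d K A (cls p q r ([var_x, var_y, var_z] ! j)))"

definition M_matrix :: "nat \<Rightarrow> nat \<Rightarrow> nat \<Rightarrow> nat \<Rightarrow> nat \<Rightarrow> 'k::field_char_0 poly3 set" where
  "M_matrix p q r i j = cls p q r (
     (let frac = (\<lambda>m n. const3 (of_nat m / of_nat n)) in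
      [[1 - var_x ^ p,
        - frac p q * var_x ^ (p - 1) * var_y,
        - frac p r * var_x ^ (p - 1) * var_z],
       [- frac q p * var_x * var_y ^ (q - 1),
        1 - var_y ^ q,
        - frac q r * var_y ^ (q - 1) * var_z],
       [- frac r p * var_x * var_z ^ (r - 1),
        - frac r q * var_y * var_z ^ (r - 1),
        1 - var_z ^ r]]) ! i ! j)"

text \<open>The operator \<open>D\<^sub>\<delta> + \<delta>(M)\<close>.\<close>

definition conn_op ::
    "nat \<Rightarrow> nat \<Rightarrow> nat \<Rightarrow> ('k::field_char_0 poly3 set \<Rightarrow> 'k poly3 set) \<Rightarrow>
     (nat \<Rightarrow> 'k poly3 set) \<Rightarrow> (nat \<Rightarrow> 'k poly3 set)" where
  "conn_op p q r \<delta> v =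
     (let A = coord_ring p q r in
       (\<lambda>i\<in>{0, 1, 2}. \<delta> (v i) \<oplus>\<^bsub>A\<^esub> (\<Oplus>\<^bsub>A\<^esub>j\<in>{0, 1, 2}. \<delta> (M_matrix p q r i j) \<otimes>\<^bsub>A\<^esub> v j)))"

end

theory Submission
  imports Defs
begin

text \<open>
  Write \<open>e = (x/p, y/q, z/r)\<close>. Euler's identity \<open>\<langle>e, dF\<rangle> = x\<^sup>p + y\<^sup>q + z\<^sup>r = 1\<close> holds on the surface, and
  \<open>M\<close> is the identity minus the rank one matrix \<open>dF e\<^sup>T\<close>. Hence \<open>M\<close> is the projection of \<open>A\<^sup>3\<close> along
  \<open>A dF\<close>, and \<open>\<Omega> = A\<^sup>3/A dF\<close> is isomorphic to the direct summand \<open>M A\<^sup>3\<close> of a free module.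

  A direct summand of a free module has a canonical connection: embed by \<open>\<psi>\<close>, differentiate entry by
  entry, and return by \<open>\<phi>\<close> (\<open>connection_of_retract\<close>). Here \<open>\<phi> : A\<^sup>3 \<rightarrow> \<Omega>\<close> is the presentation and
  \<open>\<psi> \<circ> \<phi> = M\<close> (\<open>Omega_retract\<close>), so \<open>v\<close> is sent to the class of \<open>\<delta>(M v) = \<delta>(M) v + M \<delta>(v)\<close>. Since
  \<open>M w\<close> and \<open>w\<close> differ by a multiple of \<open>dF\<close>, this is the class of \<open>\<delta>(v) + \<delta>(M) v\<close>, the operator of the
  theorem. The precise form, \<open>\<delta>(v) + \<delta>(M) v = \<delta>(M v) + \<langle>e, \<delta>(v)\<rangle> dF\<close> (\<open>conn_op_cls_vec\<close>), also shows that
  the operator maps \<open>A dF\<close> into itself: there, \<open>M v = 0\<close>.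

  The section \<open>\<psi>\<close> can be built without knowing the kernel of \<open>\<phi>\<close>. By the universal property of the
  differentials (\<open>kaehler_universal\<close>) it is enough to give a derivation of \<open>A\<close> into \<open>A\<^sup>3\<close>, and
  \<open>g \<mapsto> M grad g\<close> is one: it is well defined modulo \<open>f\<close> because \<open>M\<close> annihilates \<open>dF\<close>. That
  \<open>\<phi> \<circ> \<psi> = id\<close> is the chain rule \<open>\<phi> (grad g) = dg\<close> (\<open>to_Omega_grad\<close>).
\<close>

section \<open>Linear maps, free modules and quotient modules\<close>

lemma linear_mapsI:
  assumes "\<And>v. v \<in> carrier M \<Longrightarrow> T v \<in> carrier N"
    and "\<And>v w. v \<in> carrier M \<Longrightarrow> w \<in> carrier M \<Longrightarrow> v \<oplus>\<^bsub>M\<^esub> w \<in> carrier M"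
    and "\<And>a v. a \<in> carrier A \<Longrightarrow> v \<in> carrier M \<Longrightarrow> a \<odot>\<^bsub>M\<^esub> v \<in> carrier M"
    and "\<And>v w. v \<in> carrier M \<Longrightarrow> w \<in> carrier M \<Longrightarrow> T (v \<oplus>\<^bsub>M\<^esub> w) = T v \<oplus>\<^bsub>N\<^esub> T w"
    and "\<And>a v. a \<in> carrier A \<Longrightarrow> v \<in> carrier M \<Longrightarrow> T (a \<odot>\<^bsub>M\<^esub> v) = a \<odot>\<^bsub>N\<^esub> T v"
  shows "restrict T (carrier M) \<in> linear_maps A M N"
  using assms unfolding linear_maps_def by auto

lemma linear_mapsD:
  assumes "T \<in> linear_maps A M N"
  shows "v \<in> carrier M \<Longrightarrow> T v \<in> carrier N"
    and "v \<in> carrier M \<Longrightarrow> w \<in> carrier M \<Longrightarrow> T (v \<oplus>\<^bsub>M\<^esub> w) = T v \<oplus>\<^bsub>N\<^esub> T w"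
    and "a \<in> carrier A \<Longrightarrow> v \<in> carrier M \<Longrightarrow> T (a \<odot>\<^bsub>M\<^esub> v) = a \<odot>\<^bsub>N\<^esub> T v"
    and "T \<in> extensional (carrier M)"
  using assms unfolding linear_maps_def by (auto simp: PiE_def)

lemma linear_maps_zero:
  assumes "module A M" "module A N" "T \<in> linear_maps A M N"
  shows "T \<zero>\<^bsub>M\<^esub> = \<zero>\<^bsub>N\<^esub>"
proof -
  interpret M: module A M by fact
  interpret N: module A N by fact
  have "T (\<zero>\<^bsub>A\<^esub> \<odot>\<^bsub>M\<^esub> \<zero>\<^bsub>M\<^esub>) = \<zero>\<^bsub>A\<^esub> \<odot>\<^bsub>N\<^esub> T \<zero>\<^bsub>M\<^esub>"
    by (rule linear_mapsD(3)[OF assms(3)]) simp_all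
  then show ?thesis
    using linear_mapsD(1)[OF assms(3) M.M.zero_closed] by simp
qed

lemma linear_maps_uminus:
  assumes "module A M" "module A N" "T \<in> linear_maps A M N" "v \<in> carrier M"
  shows "T (\<ominus>\<^bsub>M\<^esub> v) = \<ominus>\<^bsub>N\<^esub> T v"
proof -
  interpret M: module A M by fact
  interpret N: module A N by fact
  note T = linear_mapsD[OF assms(3)]
  have "T (\<ominus>\<^bsub>M\<^esub> v) \<oplus>\<^bsub>N\<^esub> T v = T (\<ominus>\<^bsub>M\<^esub> v \<oplus>\<^bsub>M\<^esub> v)"
    using T(2) assms(4) by simp
  also have "\<dots> = \<zero>\<^bsub>N\<^esub>"
    using linear_maps_zero[OF assms(1-3)] assms(4) by (simp add: M.M.l_neg)
  finally show ?thesis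
    using T(1) assms(4) by (metis M.M.a_inv_closed N.M.minus_equality)
qed

lemma linear_maps_minus:
  assumes "module A M" "module A N" "T \<in> linear_maps A M N" "v \<in> carrier M" "w \<in> carrier M"
  shows "T (v \<ominus>\<^bsub>M\<^esub> w) = T v \<ominus>\<^bsub>N\<^esub> T w"
proof -
  interpret M: module A M by fact
  show ?thesis
    using assms(4,5) unfolding a_minus_def
    by (simp add: linear_mapsD(2)[OF assms(3)] linear_maps_uminus[OF assms(1-3)])
qed

lemma linear_maps_compose:
  assumes "module A L" "T \<in> linear_maps A L M" "S \<in> linear_maps A M N"
  shows "(\<lambda>v\<in>carrier L. S (T v)) \<in> linear_maps A L N"
proof -
  interpret L: module A L by fact
  show ?thesis
    by (rule linear_mapsI) (simp_all add: linear_mapsD[OF assms(2)] linear_mapsD[OF assms(3)])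
qed

lemma identity_linear:
  assumes "module A M"
  shows "(\<lambda>v\<in>carrier M. v) \<in> linear_maps A M M"
proof -
  interpret M: module A M by fact
  show ?thesis by (rule linear_mapsI) simp_all
qed

lemma zero_linear:
  assumes "module A M" "module A N"
  shows "(\<lambda>v\<in>carrier M. \<zero>\<^bsub>N\<^esub>) \<in> linear_maps A M N"
proof -
  interpret M: module A M by fact
  interpret N: module A N by fact
  show ?thesis by (rule linear_mapsI) simp_all
qed

text \<open>
  This is the tool for proving that linear maps agree: it is enough to look at generators of
  their source. Compared with the zero map, it says that kernels are submodules.
\<close>

lemma equalizer_submodule:
  assumes "module A M" "module A N" "S \<in> linear_maps A M N" "T \<in> linear_maps A M N"
  shows "submodule {v \<in> carrier M. S v = T v} A M"
proof -
  interpret M: module A M by fact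
  show ?thesis
    by (rule M.submoduleI)
      (auto simp: linear_maps_zero[OF assms(1,2)] linear_maps_uminus[OF assms(1,2)]
        linear_mapsD[OF assms(3)] linear_mapsD[OF assms(4)] assms(3,4))
qed

lemma submodule_gen_submodule:
  assumes "module A M" "S \<subseteq> carrier M"
  shows "submodule (submodule_gen A M S) A M" and "S \<subseteq> submodule_gen A M S"
proof -
  interpret M: module A M by fact
  have carrier: "submodule_gen A M S \<subseteq> carrier M"
    using M.carrier_is_submodule assms(2) unfolding submodule_gen_def by blast
  show "submodule (submodule_gen A M S) A M"
  proof (rule M.submoduleI[OF carrier])
    show "\<zero>\<^bsub>M\<^esub> \<in> submodule_gen A M S"
      unfolding submodule_gen_def using subgroup.one_closed[OF submodule.axioms(1)] by fastforce
  qed (auto simp: submodule_gen_def M.submoduleE)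
  show "S \<subseteq> submodule_gen A M S" unfolding submodule_gen_def by blast
qed

lemma free_module_simps:
  "carrier (free_module A S) = {v \<in> S \<rightarrow>\<^sub>E carrier A. finite {s \<in> S. v s \<noteq> \<zero>\<^bsub>A\<^esub>}}"
  "\<zero>\<^bsub>free_module A S\<^esub> = (\<lambda>s\<in>S. \<zero>\<^bsub>A\<^esub>)"
  "v \<oplus>\<^bsub>free_module A S\<^esub> w = (\<lambda>s\<in>S. v s \<oplus>\<^bsub>A\<^esub> w s)"
  "a \<odot>\<^bsub>free_module A S\<^esub> v = (\<lambda>s\<in>S. a \<otimes>\<^bsub>A\<^esub> v s)"
  by (simp_all add: free_module_def)

lemma free_module_module:
  assumes "cring A"
  shows "module A (free_module A S)"
proof -
  interpret A: cring A by fact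
  have add: "(\<lambda>s\<in>S. v s \<oplus>\<^bsub>A\<^esub> w s) \<in> carrier (free_module A S)"
    if "v \<in> carrier (free_module A S)" "w \<in> carrier (free_module A S)" for v w
  proof -
    have "finite ({s \<in> S. v s \<noteq> \<zero>\<^bsub>A\<^esub>} \<union> {s \<in> S. w s \<noteq> \<zero>\<^bsub>A\<^esub>})"
      using that by (simp add: free_module_simps)
    moreover have "{s \<in> S. v s \<oplus>\<^bsub>A\<^esub> w s \<noteq> \<zero>\<^bsub>A\<^esub>} \<subseteq> {s \<in> S. v s \<noteq> \<zero>\<^bsub>A\<^esub>} \<union> {s \<in> S. w s \<noteq> \<zero>\<^bsub>A\<^esub>}"
      by auto
    ultimately have "finite {s \<in> S. v s \<oplus>\<^bsub>A\<^esub> w s \<noteq> \<zero>\<^bsub>A\<^esub>}" by (rule rev_finite_subset)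
    then show ?thesis
      using that by (auto simp: free_module_simps cong: conj_cong)
  qed
  have smult: "(\<lambda>s\<in>S. a \<otimes>\<^bsub>A\<^esub> v s) \<in> carrier (free_module A S)"
    if "a \<in> carrier A" "v \<in> carrier (free_module A S)" for a v
  proof -
    have "finite {s \<in> S. v s \<noteq> \<zero>\<^bsub>A\<^esub>}" using that by (simp add: free_module_simps)
    moreover have "{s \<in> S. a \<otimes>\<^bsub>A\<^esub> v s \<noteq> \<zero>\<^bsub>A\<^esub>} \<subseteq> {s \<in> S. v s \<noteq> \<zero>\<^bsub>A\<^esub>}" using that(1) by auto
    ultimately have "finite {s \<in> S. a \<otimes>\<^bsub>A\<^esub> v s \<noteq> \<zero>\<^bsub>A\<^esub>}" by (rule rev_finite_subset)
    then show ?thesis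
      using that by (auto simp: free_module_simps cong: conj_cong)
  qed
  have val: "v s \<in> carrier A" if "v \<in> carrier (free_module A S)" "s \<in> S" for v s
    using that by (auto simp: free_module_simps)
  have eqI: "v = w" if "v \<in> carrier (free_module A S)" "w \<in> carrier (free_module A S)"
    "\<And>s. s \<in> S \<Longrightarrow> v s = w s" for v w
    using that by (auto simp: free_module_simps intro: PiE_ext)
  have zero: "(\<lambda>s\<in>S. \<zero>\<^bsub>A\<^esub>) \<in> carrier (free_module A S)"
    by (simp add: free_module_simps cong: conj_cong)
  have abelian: "abelian_group (free_module A S)"
  proof (rule abelian_groupI)
    fix v assume v: "v \<in> carrier (free_module A S)"
    \<comment> \<open>The inverse is written as a scalar multiple, so that closure is known already.\<close>
    show "\<exists>w\<in>carrier (free_module A S). w \<oplus>\<^bsub>free_module A S\<^esub> v = \<zero>\<^bsub>free_module A S\<^esub>"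
    proof (rule bexI)
      show "(\<lambda>s\<in>S. (\<ominus>\<^bsub>A\<^esub> \<one>\<^bsub>A\<^esub>) \<otimes>\<^bsub>A\<^esub> v s) \<in> carrier (free_module A S)" by (rule smult) (simp_all add: v)
      show "(\<lambda>s\<in>S. (\<ominus>\<^bsub>A\<^esub> \<one>\<^bsub>A\<^esub>) \<otimes>\<^bsub>A\<^esub> v s) \<oplus>\<^bsub>free_module A S\<^esub> v = \<zero>\<^bsub>free_module A S\<^esub>"
        unfolding free_module_simps
        by (rule restrict_ext) (simp add: val[OF v] A.l_minus A.l_neg)
    qed
  next
    fix v assume v: "v \<in> carrier (free_module A S)"
    show "\<zero>\<^bsub>free_module A S\<^esub> \<oplus>\<^bsub>free_module A S\<^esub> v = v"
      unfolding free_module_simps(2,3) by (rule eqI[OF add[OF zero v] v]) (simp add: val[OF v])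
  next
    fix u v w assume uvw: "u \<in> carrier (free_module A S)" "v \<in> carrier (free_module A S)"
      "w \<in> carrier (free_module A S)"
    show "u \<oplus>\<^bsub>free_module A S\<^esub> v \<oplus>\<^bsub>free_module A S\<^esub> w = u \<oplus>\<^bsub>free_module A S\<^esub> (v \<oplus>\<^bsub>free_module A S\<^esub> w)"
      unfolding free_module_simps(3) by (rule restrict_ext) (simp add: val uvw A.a_assoc)
  next
    fix u v assume uv: "u \<in> carrier (free_module A S)" "v \<in> carrier (free_module A S)"
    show "u \<oplus>\<^bsub>free_module A S\<^esub> v = v \<oplus>\<^bsub>free_module A S\<^esub> u"
      unfolding free_module_simps(3) by (rule restrict_ext) (simp add: val uv A.a_comm)
  qed (simp_all add: free_module_simps(2,3) add zero)
  show ?thesis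
  proof (rule moduleI[OF assms abelian])
    fix v assume v: "v \<in> carrier (free_module A S)"
    show "\<one>\<^bsub>A\<^esub> \<odot>\<^bsub>free_module A S\<^esub> v = v"
      by (rule eqI) (simp_all add: free_module_simps(4) smult v val)
  next
    fix a v assume a: "a \<in> carrier A" and v: "v \<in> carrier (free_module A S)"
    show "a \<odot>\<^bsub>free_module A S\<^esub> v \<in> carrier (free_module A S)"
      unfolding free_module_simps(4) by (rule smult) fact+
    fix b assume b: "b \<in> carrier A"
    show "(a \<oplus>\<^bsub>A\<^esub> b) \<odot>\<^bsub>free_module A S\<^esub> v =
        a \<odot>\<^bsub>free_module A S\<^esub> v \<oplus>\<^bsub>free_module A S\<^esub> b \<odot>\<^bsub>free_module A S\<^esub> v"
      unfolding free_module_simps(3,4) by (rule restrict_ext) (simp add: a b v val A.l_distr)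
    show "(a \<otimes>\<^bsub>A\<^esub> b) \<odot>\<^bsub>free_module A S\<^esub> v = a \<odot>\<^bsub>free_module A S\<^esub> (b \<odot>\<^bsub>free_module A S\<^esub> v)"
      unfolding free_module_simps(4) by (rule restrict_ext) (simp add: a b v val A.m_assoc)
  next
    fix a v w assume a: "a \<in> carrier A"
      and vw: "v \<in> carrier (free_module A S)" "w \<in> carrier (free_module A S)"
    show "a \<odot>\<^bsub>free_module A S\<^esub> (v \<oplus>\<^bsub>free_module A S\<^esub> w) =
        a \<odot>\<^bsub>free_module A S\<^esub> v \<oplus>\<^bsub>free_module A S\<^esub> a \<odot>\<^bsub>free_module A S\<^esub> w"
      unfolding free_module_simps(3,4) by (rule restrict_ext) (simp add: a vw val A.r_distr)
  qed
qed

lemma free_gen_closed: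
  assumes "cring A"
  shows "free_gen A S s \<in> carrier (free_module A S)"
proof -
  interpret A: cring A by fact
  have "finite {t \<in> S. free_gen A S s t \<noteq> \<zero>\<^bsub>A\<^esub>}"
    by (rule finite_subset[of _ "{s}"]) (auto simp: free_gen_def)
  then show ?thesis by (auto simp: free_module_simps free_gen_def)
qed

text \<open>
  Induction on a finite set that contains the support of a vector: clearing the entry at \<open>t\<close>
  makes the set smaller, and that entry times the generator at \<open>t\<close> restores the vector.
\<close>

lemma free_module_spanned:
  assumes "cring A" and N: "submodule N A (free_module A S)"
    and gens: "\<And>s. s \<in> S \<Longrightarrow> free_gen A S s \<in> N"
  shows "N = carrier (free_module A S)"
proof -
  interpret A: cring A by fact
  interpret F: module A "free_module A S" by (rule free_module_module) fact
  have "v \<in> N" if "finite T" "v \<in> carrier (free_module A S)" "{s \<in> S. v s \<noteq> \<zero>\<^bsub>A\<^esub>} \<subseteq> T" for T v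
    using that
  proof (induction T arbitrary: v rule: finite_induct)
    case empty
    then have "v = \<zero>\<^bsub>free_module A S\<^esub>"
      by (auto simp: free_module_simps intro!: PiE_ext[of v])
    then show ?case using subgroup.one_closed[OF submodule.axioms(1)[OF N]] by simp
  next
    case (insert t T)
    show ?case
    proof (cases "t \<in> S")
      case False
      then show ?thesis using insert by auto
    next
      case True
      define w where "w = v(t := \<zero>\<^bsub>A\<^esub>)"
      have vt: "v t \<in> carrier A" using insert.prems(1) True by (auto simp: free_module_simps)
      have "{s \<in> S. w s \<noteq> \<zero>\<^bsub>A\<^esub>} \<subseteq> T" using insert.prems(2) by (auto simp: w_def)
      moreover have "w \<in> carrier (free_module A S)"
        using insert.prems(1) True finite_subset[OF calculation insert.hyps(1)]
        by (auto simp: free_module_simps w_def PiE_def extensional_def)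
      ultimately have "w \<in> N" by (intro insert.IH)
      moreover have "v t \<odot>\<^bsub>free_module A S\<^esub> free_gen A S t \<in> N"
        using F.submoduleE(4)[OF N] gens True vt by blast
      moreover have "v = w \<oplus>\<^bsub>free_module A S\<^esub> v t \<odot>\<^bsub>free_module A S\<^esub> free_gen A S t"
      proof (rule ext)
        fix s
        have v: "v \<in> S \<rightarrow>\<^sub>E carrier A" using insert.prems(1) by (simp add: free_module_simps)
        show "v s = (w \<oplus>\<^bsub>free_module A S\<^esub> v t \<odot>\<^bsub>free_module A S\<^esub> free_gen A S t) s"
        proof (cases "s \<in> S")
          case False
          then show ?thesis using PiE_arb[OF v] by (simp add: free_module_simps(3))
        next
          case True
          then show ?thesis using PiE_mem[OF v True] vt
            by (simp add: free_module_simps(3,4) free_gen_def w_def)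
        qed
      qed
      ultimately show ?thesis
        using subst[of _ v "\<lambda>u. u \<in> N", OF sym] F.submoduleE(5)[OF N] by blast
    qed
  qed
  then show ?thesis
    using F.submoduleE(1)[OF N] by (auto simp: free_module_simps)
qed

text \<open>
  The map is \<open>v \<mapsto> \<Sum> v s h s\<close>. The sum ranges over the support of \<open>v\<close>; to compare the sums for
  \<open>v\<close>, \<open>w\<close> and \<open>v + w\<close>, all three are taken over the union of the supports of \<open>v\<close> and \<open>w\<close>.
\<close>

lemma free_module_universal:
  assumes "cring A" and W: "module A W" and h: "\<And>s. s \<in> S \<Longrightarrow> h s \<in> carrier W"
  obtains T where "T \<in> linear_maps A (free_module A S) W"
    and "\<And>s. s \<in> S \<Longrightarrow> T (free_gen A S s) = h s"
proof -
  interpret A: cring A by fact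
  interpret F: module A "free_module A S" by (rule free_module_module) fact
  interpret W: module A W by fact
  define T where "T v = (\<Oplus>\<^bsub>W\<^esub>s\<in>{s \<in> S. v s \<noteq> \<zero>\<^bsub>A\<^esub>}. v s \<odot>\<^bsub>W\<^esub> h s)" for v
  have val: "v s \<in> carrier A" if "v \<in> carrier (free_module A S)" "s \<in> S" for v s
    using that by (auto simp: free_module_simps)
  have T: "T v = (\<Oplus>\<^bsub>W\<^esub>s\<in>B. v s \<odot>\<^bsub>W\<^esub> h s)"
    if "v \<in> carrier (free_module A S)" "finite B" "B \<subseteq> S" "{s \<in> S. v s \<noteq> \<zero>\<^bsub>A\<^esub>} \<subseteq> B" for v B
    unfolding T_def using that
    by (intro W.M.add.finprod_mono_neutral_cong_left) (auto simp: val h subset_eq)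
  have closed: "T v \<in> carrier W" if "v \<in> carrier (free_module A S)" for v
    unfolding T_def using that by (intro W.M.finsum_closed) (auto simp: val h)
  have "restrict T (carrier (free_module A S)) \<in> linear_maps A (free_module A S) W"
  proof (rule linear_mapsI)
    fix v w assume vw: "v \<in> carrier (free_module A S)" "w \<in> carrier (free_module A S)"
    let ?B = "{s \<in> S. v s \<noteq> \<zero>\<^bsub>A\<^esub>} \<union> {s \<in> S. w s \<noteq> \<zero>\<^bsub>A\<^esub>}"
    have B: "finite ?B" "?B \<subseteq> S" using vw by (auto simp: free_module_simps)
    have "T (v \<oplus>\<^bsub>free_module A S\<^esub> w) = (\<Oplus>\<^bsub>W\<^esub>s\<in>?B. (v \<oplus>\<^bsub>free_module A S\<^esub> w) s \<odot>\<^bsub>W\<^esub> h s)"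
      by (rule T[OF F.M.a_closed[OF vw] B]) (auto simp: free_module_simps(3))
    also have "\<dots> = (\<Oplus>\<^bsub>W\<^esub>s\<in>?B. v s \<odot>\<^bsub>W\<^esub> h s \<oplus>\<^bsub>W\<^esub> w s \<odot>\<^bsub>W\<^esub> h s)"
      by (rule W.M.finsum_cong')
        (auto simp: free_module_simps(3) val[OF vw(1)] val[OF vw(2)] h W.smult_l_distr)
    also have "\<dots> = T v \<oplus>\<^bsub>W\<^esub> T w"
      unfolding T[OF vw(1) B Un_upper1] T[OF vw(2) B Un_upper2]
      by (rule W.M.finsum_addf) (auto simp: val[OF vw(1)] val[OF vw(2)] h)
    finally show "T (v \<oplus>\<^bsub>free_module A S\<^esub> w) = T v \<oplus>\<^bsub>W\<^esub> T w" .
  next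
    fix a v assume av: "a \<in> carrier A" "v \<in> carrier (free_module A S)"
    let ?B = "{s \<in> S. v s \<noteq> \<zero>\<^bsub>A\<^esub>}"
    have B: "finite ?B" "?B \<subseteq> S" using av by (auto simp: free_module_simps)
    have "T (a \<odot>\<^bsub>free_module A S\<^esub> v) = (\<Oplus>\<^bsub>W\<^esub>s\<in>?B. (a \<odot>\<^bsub>free_module A S\<^esub> v) s \<odot>\<^bsub>W\<^esub> h s)"
      by (rule T[OF F.smult_closed[OF av] B]) (auto simp: free_module_simps(4) av)
    also have "\<dots> = (\<Oplus>\<^bsub>W\<^esub>s\<in>?B. a \<odot>\<^bsub>W\<^esub> (v s \<odot>\<^bsub>W\<^esub> h s))"
      by (rule W.M.finsum_cong')
        (auto simp: free_module_simps(4) val[OF av(2)] av(1) h W.smult_assoc1)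
    also have "\<dots> = a \<odot>\<^bsub>W\<^esub> T v"
      unfolding T_def
      by (rule W.finsum_smult_ldistr[symmetric]) (use B in \<open>auto simp: val[OF av(2)] av(1) h\<close>)
    finally show "T (a \<odot>\<^bsub>free_module A S\<^esub> v) = a \<odot>\<^bsub>W\<^esub> T v" .
  qed (simp_all add: closed)
  moreover have "restrict T (carrier (free_module A S)) (free_gen A S s) = h s" if s: "s \<in> S" for s
  proof -
    have "T (free_gen A S s) = (\<Oplus>\<^bsub>W\<^esub>t\<in>{s}. free_gen A S s t \<odot>\<^bsub>W\<^esub> h t)"
      by (rule T[OF free_gen_closed[OF assms(1)]]) (use s in \<open>auto simp: free_gen_def\<close>)
    also have "\<dots> = h s" using s h by (simp add: free_gen_def)
    finally show ?thesis by (simp add: free_gen_closed[OF assms(1)])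
  qed
  ultimately show ?thesis by (rule that)
qed

lemma quot_module_simps:
  "carrier (quot_module M N) = a_rcosets\<^bsub>M\<^esub> N"
  "\<zero>\<^bsub>quot_module M N\<^esub> = N"
  "C \<oplus>\<^bsub>quot_module M N\<^esub> D = C <+>\<^bsub>M\<^esub> D"
  "a \<odot>\<^bsub>quot_module M N\<^esub> C = (\<Union>x\<in>C. N +>\<^bsub>M\<^esub> (a \<odot>\<^bsub>M\<^esub> x))"
  by (simp_all add: quot_module_def)

lemma submodule_abelian_subgroup:
  assumes "module A M" "submodule N A M"
  shows "abelian_subgroup N M"
proof -
  interpret M: module A M by fact
  show ?thesis
    by (intro abelian_subgroupI3 additive_subgroupI submodule.axioms(1)[OF assms(2)])
      (rule M.abelian_group_axioms)
qed

lemma coset_eq_iff: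
  assumes "module A M" "submodule N A M" "v \<in> carrier M" "w \<in> carrier M"
  shows "N +>\<^bsub>M\<^esub> v = N +>\<^bsub>M\<^esub> w \<longleftrightarrow> v \<ominus>\<^bsub>M\<^esub> w \<in> N"
proof -
  interpret N: abelian_subgroup N M by (rule submodule_abelian_subgroup) fact+
  show ?thesis
    unfolding a_minus_def N.a_rcos_module[OF assms(4,3), symmetric]
    using N.a_repr_independence' N.a_rcos_self assms(3,4) by metis
qed

text \<open>
  Everything about the quotient module is computed with representatives by these rules. The scalar
  multiple of a coset is defined as a union over representatives, whose members coincide because a
  submodule absorbs scalars.
\<close>

lemma quot_module_coset:
  assumes "module A M" "submodule N A M"
  shows "v \<in> carrier M \<Longrightarrow> w \<in> carrier M \<Longrightarrow>
      (N +>\<^bsub>M\<^esub> v) \<oplus>\<^bsub>quot_module M N\<^esub> (N +>\<^bsub>M\<^esub> w) = N +>\<^bsub>M\<^esub> (v \<oplus>\<^bsub>M\<^esub> w)"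
    and "a \<in> carrier A \<Longrightarrow> v \<in> carrier M \<Longrightarrow>
      a \<odot>\<^bsub>quot_module M N\<^esub> (N +>\<^bsub>M\<^esub> v) = N +>\<^bsub>M\<^esub> (a \<odot>\<^bsub>M\<^esub> v)"
    and "v \<in> carrier M \<Longrightarrow> N +>\<^bsub>M\<^esub> v \<in> carrier (quot_module M N)"
    and "C \<in> carrier (quot_module M N) \<Longrightarrow> \<exists>v\<in>carrier M. C = N +>\<^bsub>M\<^esub> v"
proof -
  interpret M: module A M by fact
  interpret N: abelian_subgroup N M by (rule submodule_abelian_subgroup) fact+
  show "(N +>\<^bsub>M\<^esub> v) \<oplus>\<^bsub>quot_module M N\<^esub> (N +>\<^bsub>M\<^esub> w) = N +>\<^bsub>M\<^esub> (v \<oplus>\<^bsub>M\<^esub> w)"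
    if "v \<in> carrier M" "w \<in> carrier M"
    unfolding quot_module_simps by (rule N.a_rcos_sum) fact+
  show "a \<odot>\<^bsub>quot_module M N\<^esub> (N +>\<^bsub>M\<^esub> v) = N +>\<^bsub>M\<^esub> (a \<odot>\<^bsub>M\<^esub> v)"
    if a: "a \<in> carrier A" and v: "v \<in> carrier M"
  proof -
    have "N +>\<^bsub>M\<^esub> (a \<odot>\<^bsub>M\<^esub> x) = N +>\<^bsub>M\<^esub> (a \<odot>\<^bsub>M\<^esub> v)" if x: "x \<in> N +>\<^bsub>M\<^esub> v" for x
    proof -
      have xM: "x \<in> carrier M" using N.a_elemrcos_carrier[OF v x] .
      have "x \<ominus>\<^bsub>M\<^esub> v \<in> N" unfolding a_minus_def by (rule N.a_rcos_module_imp) fact+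
      then have "a \<odot>\<^bsub>M\<^esub> (x \<ominus>\<^bsub>M\<^esub> v) \<in> N" by (rule submodule.smult_closed[OF assms(2) a])
      then show ?thesis
        using a v xM by (simp add: coset_eq_iff[OF assms] a_minus_def M.smult_r_distr M.smult_r_minus)
    qed
    moreover have "v \<in> N +>\<^bsub>M\<^esub> v" by (rule N.a_rcos_self) fact
    ultimately show ?thesis unfolding quot_module_simps by blast
  qed
  show "N +>\<^bsub>M\<^esub> v \<in> carrier (quot_module M N)" if "v \<in> carrier M"
    unfolding quot_module_simps using M.a_rcosetsI[OF N.a_subset that] .
  show "\<exists>v\<in>carrier M. C = N +>\<^bsub>M\<^esub> v" if "C \<in> carrier (quot_module M N)"
    using that unfolding quot_module_simps A_RCOSETS_def' by blast
qed

lemma quot_module_module: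
  assumes "module A M" "submodule N A M"
  shows "module A (quot_module M N)"
proof -
  interpret M: module A M by fact
  interpret N: abelian_subgroup N M by (rule submodule_abelian_subgroup) fact+
  note coset = quot_module_coset[OF assms]
  have zero: "\<zero>\<^bsub>quot_module M N\<^esub> = N +>\<^bsub>M\<^esub> \<zero>\<^bsub>M\<^esub>"
    unfolding quot_module_simps by (rule M.a_coset_add_zero[symmetric]) (rule N.a_subset)
  note rep = bexE[OF coset(4)]
  show ?thesis
  proof (rule moduleI)
    show "cring A" by (rule M.R.cring_axioms)
    show "abelian_group (quot_module M N)"
    proof (rule abelian_groupI)
      fix C assume "C \<in> carrier (quot_module M N)"
      then obtain v where v: "v \<in> carrier M" "C = N +>\<^bsub>M\<^esub> v" by (rule rep)
      then show "\<exists>D\<in>carrier (quot_module M N). D \<oplus>\<^bsub>quot_module M N\<^esub> C = \<zero>\<^bsub>quot_module M N\<^esub>"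
        by (intro bexI[of _ "N +>\<^bsub>M\<^esub> (\<ominus>\<^bsub>M\<^esub> v)"]) (simp_all add: zero coset M.M.l_neg)
      from v show "\<zero>\<^bsub>quot_module M N\<^esub> \<oplus>\<^bsub>quot_module M N\<^esub> C = C" by (simp add: zero coset)
    next
      fix C D assume "C \<in> carrier (quot_module M N)" "D \<in> carrier (quot_module M N)"
      then obtain v w where "v \<in> carrier M" "w \<in> carrier M" "C = N +>\<^bsub>M\<^esub> v" "D = N +>\<^bsub>M\<^esub> w"
        by (metis coset(4))
      then show "C \<oplus>\<^bsub>quot_module M N\<^esub> D \<in> carrier (quot_module M N)"
        and "C \<oplus>\<^bsub>quot_module M N\<^esub> D = D \<oplus>\<^bsub>quot_module M N\<^esub> C"
        by (simp_all add: coset M.M.a_comm)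
      fix E assume "E \<in> carrier (quot_module M N)"
      then obtain u where "u \<in> carrier M" "E = N +>\<^bsub>M\<^esub> u" by (rule rep)
      with \<open>v \<in> _\<close> \<open>w \<in> _\<close> \<open>C = _\<close> \<open>D = _\<close>
      show "C \<oplus>\<^bsub>quot_module M N\<^esub> D \<oplus>\<^bsub>quot_module M N\<^esub> E = C \<oplus>\<^bsub>quot_module M N\<^esub> (D \<oplus>\<^bsub>quot_module M N\<^esub> E)"
        by (simp add: coset M.M.a_assoc)
    qed (simp add: zero coset)
  next
    fix a C assume a: "a \<in> carrier A" and "C \<in> carrier (quot_module M N)"
    then obtain v where v: "v \<in> carrier M" "C = N +>\<^bsub>M\<^esub> v" by (metis coset(4))
    with a show "a \<odot>\<^bsub>quot_module M N\<^esub> C \<in> carrier (quot_module M N)" by (simp add: coset)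
    fix b assume b: "b \<in> carrier A"
    show "(a \<oplus>\<^bsub>A\<^esub> b) \<odot>\<^bsub>quot_module M N\<^esub> C = a \<odot>\<^bsub>quot_module M N\<^esub> C \<oplus>\<^bsub>quot_module M N\<^esub> b \<odot>\<^bsub>quot_module M N\<^esub> C"
      and "(a \<otimes>\<^bsub>A\<^esub> b) \<odot>\<^bsub>quot_module M N\<^esub> C = a \<odot>\<^bsub>quot_module M N\<^esub> (b \<odot>\<^bsub>quot_module M N\<^esub> C)"
      using a b v by (simp_all add: coset M.smult_l_distr M.smult_assoc1)
  next
    fix a C D assume a: "a \<in> carrier A" and "C \<in> carrier (quot_module M N)" "D \<in> carrier (quot_module M N)"
    then obtain v w where "v \<in> carrier M" "w \<in> carrier M" "C = N +>\<^bsub>M\<^esub> v" "D = N +>\<^bsub>M\<^esub> w"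
      by (metis coset(4))
    with a show "a \<odot>\<^bsub>quot_module M N\<^esub> (C \<oplus>\<^bsub>quot_module M N\<^esub> D) = a \<odot>\<^bsub>quot_module M N\<^esub> C \<oplus>\<^bsub>quot_module M N\<^esub> a \<odot>\<^bsub>quot_module M N\<^esub> D"
      by (simp add: coset M.smult_r_distr)
  next
    fix C assume "C \<in> carrier (quot_module M N)"
    then obtain v where "v \<in> carrier M" "C = N +>\<^bsub>M\<^esub> v" by (rule rep)
    then show "\<one>\<^bsub>A\<^esub> \<odot>\<^bsub>quot_module M N\<^esub> C = C" by (simp add: coset)
  qed
qed

lemma quot_module_universal:
  assumes M: "module A M" and N: "submodule N A M" and W: "module A W"
    and T: "T \<in> linear_maps A M W" and zero: "\<And>n. n \<in> N \<Longrightarrow> T n = \<zero>\<^bsub>W\<^esub>"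
  obtains T' where "T' \<in> linear_maps A (quot_module M N) W"
    and "\<And>v. v \<in> carrier M \<Longrightarrow> T' (N +>\<^bsub>M\<^esub> v) = T v"
proof -
  interpret M: module A M by fact
  interpret W: module A W by fact
  interpret N: abelian_subgroup N M by (rule submodule_abelian_subgroup) fact+
  interpret Q: module A "quot_module M N" by (rule quot_module_module) fact+
  note coset = quot_module_coset[OF M N]
  \<comment> \<open>\<open>T\<close> is constant on each coset, so the image of a coset is a singleton.\<close>
  define T' where "T' C = the_elem (T ` C)" for C
  have T': "T' (N +>\<^bsub>M\<^esub> v) = T v" if v: "v \<in> carrier M" for v
  proof -
    have "T x = T v" if x: "x \<in> N +>\<^bsub>M\<^esub> v" for x
    proof -
      have xM: "x \<in> carrier M" using N.a_elemrcos_carrier[OF v x] .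
      have "T x \<ominus>\<^bsub>W\<^esub> T v = T (x \<ominus>\<^bsub>M\<^esub> v)" by (rule linear_maps_minus[OF M W T xM v, symmetric])
      also have "x \<ominus>\<^bsub>M\<^esub> v \<in> N" unfolding a_minus_def by (rule N.a_rcos_module_imp) fact+
      then have "T (x \<ominus>\<^bsub>M\<^esub> v) = \<zero>\<^bsub>W\<^esub>" by (rule zero)
      finally show ?thesis
        using W.M.minus_equality[of "T x" "\<ominus>\<^bsub>W\<^esub> T v"] linear_mapsD(1)[OF T] xM v
        by (simp add: a_minus_def)
    qed
    moreover have "v \<in> N +>\<^bsub>M\<^esub> v" by (rule N.a_rcos_self) fact
    ultimately have "T ` (N +>\<^bsub>M\<^esub> v) = {T v}" by blast
    then show ?thesis by (simp add: T'_def)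
  qed
  have "restrict T' (carrier (quot_module M N)) \<in> linear_maps A (quot_module M N) W"
  proof (rule linear_mapsI)
    fix C D assume "C \<in> carrier (quot_module M N)" "D \<in> carrier (quot_module M N)"
    then obtain v w where "v \<in> carrier M" "w \<in> carrier M" "C = N +>\<^bsub>M\<^esub> v" "D = N +>\<^bsub>M\<^esub> w"
      by (metis coset(4))
    then show "T' (C \<oplus>\<^bsub>quot_module M N\<^esub> D) = T' C \<oplus>\<^bsub>W\<^esub> T' D" and "T' C \<in> carrier W"
      by (simp_all add: coset T' linear_mapsD[OF T])
  next
    fix a C assume "a \<in> carrier A" "C \<in> carrier (quot_module M N)"
    moreover from this obtain v where "v \<in> carrier M" "C = N +>\<^bsub>M\<^esub> v" by (metis coset(4))
    ultimately show "T' (a \<odot>\<^bsub>quot_module M N\<^esub> C) = a \<odot>\<^bsub>W\<^esub> T' C"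
      by (simp add: coset T' linear_mapsD[OF T])
  qed simp_all
  then show ?thesis by (rule that) (simp add: coset T')
qed


section \<open>Kaehler differentials\<close>

text \<open>
  Given the product rule, \<open>d\<close> vanishes on \<open>K\<close> exactly if it is \<open>K\<close>-linear. The former condition is
  the one that appears among the relations of the differentials.
\<close>

definition derivation_into ::
    "'a set \<Rightarrow> 'a ring \<Rightarrow> ('a, 'm) module \<Rightarrow> ('a \<Rightarrow> 'm) \<Rightarrow> bool" where
  "derivation_into K A W d \<longleftrightarrow>
     (\<forall>a\<in>carrier A. d a \<in> carrier W) \<and>
     (\<forall>a\<in>carrier A. \<forall>b\<in>carrier A. d (a \<oplus>\<^bsub>A\<^esub> b) = d a \<oplus>\<^bsub>W\<^esub> d b) \<and>
     (\<forall>a\<in>carrier A. \<forall>b\<in>carrier A. d (a \<otimes>\<^bsub>A\<^esub> b) = a \<odot>\<^bsub>W\<^esub> d b \<oplus>\<^bsub>W\<^esub> b \<odot>\<^bsub>W\<^esub> d a) \<and>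
     (\<forall>c\<in>K. d c = \<zero>\<^bsub>W\<^esub>)"

lemma derivation_intoD:
  assumes "derivation_into K A W d"
  shows "a \<in> carrier A \<Longrightarrow> d a \<in> carrier W"
    and "a \<in> carrier A \<Longrightarrow> b \<in> carrier A \<Longrightarrow> d (a \<oplus>\<^bsub>A\<^esub> b) = d a \<oplus>\<^bsub>W\<^esub> d b"
    and "a \<in> carrier A \<Longrightarrow> b \<in> carrier A \<Longrightarrow>
      d (a \<otimes>\<^bsub>A\<^esub> b) = a \<odot>\<^bsub>W\<^esub> d b \<oplus>\<^bsub>W\<^esub> b \<odot>\<^bsub>W\<^esub> d a"
    and "c \<in> K \<Longrightarrow> d c = \<zero>\<^bsub>W\<^esub>"
  using assms unfolding derivation_into_def by blast+

lemma kaehler_relations_cases [consumes 1, case_names add mult const]: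
  assumes "v \<in> kaehler_relations K A"
  obtains a b where "a \<in> carrier A" "b \<in> carrier A"
      "v = free_gen A (carrier A) (a \<oplus>\<^bsub>A\<^esub> b) \<ominus>\<^bsub>free_module A (carrier A)\<^esub>
        (free_gen A (carrier A) a \<oplus>\<^bsub>free_module A (carrier A)\<^esub> free_gen A (carrier A) b)"
    | a b where "a \<in> carrier A" "b \<in> carrier A"
      "v = free_gen A (carrier A) (a \<otimes>\<^bsub>A\<^esub> b) \<ominus>\<^bsub>free_module A (carrier A)\<^esub>
        (a \<odot>\<^bsub>free_module A (carrier A)\<^esub> free_gen A (carrier A) b
          \<oplus>\<^bsub>free_module A (carrier A)\<^esub> b \<odot>\<^bsub>free_module A (carrier A)\<^esub> free_gen A (carrier A) a)"
    | c where "c \<in> K" "v = free_gen A (carrier A) c"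
  using assms unfolding kaehler_relations_def Let_def by blast

lemma kaehler_relationsI:
  "a \<in> carrier A \<Longrightarrow> b \<in> carrier A \<Longrightarrow>
    free_gen A (carrier A) (a \<oplus>\<^bsub>A\<^esub> b) \<ominus>\<^bsub>free_module A (carrier A)\<^esub>
      (free_gen A (carrier A) a \<oplus>\<^bsub>free_module A (carrier A)\<^esub> free_gen A (carrier A) b)
    \<in> kaehler_relations K A"
  "a \<in> carrier A \<Longrightarrow> b \<in> carrier A \<Longrightarrow>
    free_gen A (carrier A) (a \<otimes>\<^bsub>A\<^esub> b) \<ominus>\<^bsub>free_module A (carrier A)\<^esub>
      (a \<odot>\<^bsub>free_module A (carrier A)\<^esub> free_gen A (carrier A) b
        \<oplus>\<^bsub>free_module A (carrier A)\<^esub> b \<odot>\<^bsub>free_module A (carrier A)\<^esub> free_gen A (carrier A) a)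
    \<in> kaehler_relations K A"
  "c \<in> K \<Longrightarrow> free_gen A (carrier A) c \<in> kaehler_relations K A"
  unfolding kaehler_relations_def Let_def by blast+

lemma kaehler_relations_closed:
  assumes "cring A" "K \<subseteq> carrier A"
  shows "kaehler_relations K A \<subseteq> carrier (free_module A (carrier A))"
proof -
  interpret F: module A "free_module A (carrier A)" by (rule free_module_module) fact
  show ?thesis
  proof
    fix v assume "v \<in> kaehler_relations K A"
    then show "v \<in> carrier (free_module A (carrier A))"
      by (cases rule: kaehler_relations_cases) (simp_all add: free_gen_closed[OF assms(1)])
  qed
qed

lemma kaehler_module:
  assumes "cring A" "K \<subseteq> carrier A"
  shows "module A (kaehler K A)"
  unfolding kaehler_def
  by (intro quot_module_module free_module_module submodule_gen_submodule kaehler_relations_closed assms)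

text \<open>
  The defining relations of the differentials are precisely the laws of a derivation.
\<close>

lemma kaehler_d_derivation:
  assumes "cring A" "K \<subseteq> carrier A"
  shows "derivation_into K A (kaehler K A) (kaehler_d K A)"
proof -
  let ?F = "free_module A (carrier A)" and ?e = "free_gen A (carrier A)"
  let ?N = "submodule_gen A ?F (kaehler_relations K A)"
  interpret A: cring A by fact
  interpret F: module A ?F by (rule free_module_module) fact
  note N = submodule_gen_submodule[OF F.module_axioms kaehler_relations_closed[OF assms]]
  note coset = quot_module_coset[OF F.module_axioms N(1)]
  note eqI = iffD2[OF coset_eq_iff[OF F.module_axioms N(1)]]
  interpret N: abelian_subgroup ?N ?F
    by (rule submodule_abelian_subgroup) (rule F.module_axioms N(1))+
  note e = free_gen_closed[OF assms(1), of "carrier A"]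
  show ?thesis
    unfolding derivation_into_def kaehler_def kaehler_d_def
  proof (intro conjI ballI)
    fix a assume a: "a \<in> carrier A"
    show "?N +>\<^bsub>?F\<^esub> ?e a \<in> carrier (quot_module ?F ?N)" by (simp add: coset e)
    fix b assume b: "b \<in> carrier A"
    have "?N +>\<^bsub>?F\<^esub> ?e (a \<oplus>\<^bsub>A\<^esub> b) = ?N +>\<^bsub>?F\<^esub> (?e a \<oplus>\<^bsub>?F\<^esub> ?e b)"
      using a b by (intro eqI subsetD[OF N(2)] kaehler_relationsI) (simp_all add: e)
    then show "?N +>\<^bsub>?F\<^esub> ?e (a \<oplus>\<^bsub>A\<^esub> b) =
        (?N +>\<^bsub>?F\<^esub> ?e a) \<oplus>\<^bsub>quot_module ?F ?N\<^esub> (?N +>\<^bsub>?F\<^esub> ?e b)"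
      by (simp add: coset e)
    have "?N +>\<^bsub>?F\<^esub> ?e (a \<otimes>\<^bsub>A\<^esub> b) = ?N +>\<^bsub>?F\<^esub> (a \<odot>\<^bsub>?F\<^esub> ?e b \<oplus>\<^bsub>?F\<^esub> b \<odot>\<^bsub>?F\<^esub> ?e a)"
      using a b by (intro eqI subsetD[OF N(2)] kaehler_relationsI) (simp_all add: e)
    then show "?N +>\<^bsub>?F\<^esub> ?e (a \<otimes>\<^bsub>A\<^esub> b) =
        a \<odot>\<^bsub>quot_module ?F ?N\<^esub> (?N +>\<^bsub>?F\<^esub> ?e b)
          \<oplus>\<^bsub>quot_module ?F ?N\<^esub> b \<odot>\<^bsub>quot_module ?F ?N\<^esub> (?N +>\<^bsub>?F\<^esub> ?e a)"
      by (simp add: coset e a b)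
  next
    fix c assume "c \<in> K"
    then have "?e c \<in> ?N"
      by (intro subsetD[OF N(2)] kaehler_relationsI)
    then show "?N +>\<^bsub>?F\<^esub> ?e c = \<zero>\<^bsub>quot_module ?F ?N\<^esub>"
      unfolding quot_module_simps by (rule N.a_rcos_const)
  qed
qed

text \<open>
  The linear map on the free module that sends \<open>da\<close> to \<open>d a\<close> has a submodule as its kernel, and the
  kernel contains the defining relations, hence all that they generate.
\<close>

lemma kaehler_universal:
  assumes "cring A" "K \<subseteq> carrier A" and W: "module A W" and d: "derivation_into K A W d"
  obtains \<psi> where "\<psi> \<in> linear_maps A (kaehler K A) W"
    and "\<And>a. a \<in> carrier A \<Longrightarrow> \<psi> (kaehler_d K A a) = d a"
proof -
  let ?F = "free_module A (carrier A)" and ?e = "free_gen A (carrier A)"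
  let ?N = "submodule_gen A ?F (kaehler_relations K A)"
  interpret A: cring A by fact
  interpret F: module A ?F by (rule free_module_module) fact
  interpret W: module A W by fact
  note N = submodule_gen_submodule[OF F.module_axioms kaehler_relations_closed[OF assms(1,2)]]
  note e = free_gen_closed[OF assms(1), of "carrier A"]
  obtain T where T: "T \<in> linear_maps A ?F W" "\<And>a. a \<in> carrier A \<Longrightarrow> T (?e a) = d a"
    by (rule free_module_universal[OF assms(1) W, of "carrier A" d, OF derivation_intoD(1)[OF d]])
      (assumption | rule that)+
  define zero where "zero = (\<lambda>v\<in>carrier ?F. \<zero>\<^bsub>W\<^esub>)"
  have zero: "zero \<in> linear_maps A ?F W"
    unfolding zero_def by (rule zero_linear) (rule F.module_axioms W)+
  note minus = linear_maps_minus[OF F.module_axioms W T(1)]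
  have self: "w \<ominus>\<^bsub>W\<^esub> w = \<zero>\<^bsub>W\<^esub>" if "w \<in> carrier W" for w
    using that by (simp add: a_minus_def W.M.r_neg)
  have "kaehler_relations K A \<subseteq> {v \<in> carrier ?F. T v = zero v}"
  proof
    fix v assume v: "v \<in> kaehler_relations K A"
    then have "T v = \<zero>\<^bsub>W\<^esub>"
    proof (cases rule: kaehler_relations_cases)
      case (add a b)
      then show ?thesis
        by (simp add: minus e linear_mapsD[OF T(1)] T(2) derivation_intoD[OF d] self)
    next
      case (mult a b)
      then show ?thesis
        by (simp add: minus e linear_mapsD[OF T(1)] T(2) derivation_intoD[OF d] self)
    next
      case (const c)
      then show ?thesis using assms(2) by (simp add: T(2) derivation_intoD[OF d] subset_eq)
    qed
    then show "v \<in> {v \<in> carrier ?F. T v = zero v}"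
      using v kaehler_relations_closed[OF assms(1,2)] by (auto simp: zero_def)
  qed
  then have "?N \<subseteq> {v \<in> carrier ?F. T v = zero v}"
    using equalizer_submodule[OF F.module_axioms W T(1) zero] unfolding submodule_gen_def by blast
  then have "T n = \<zero>\<^bsub>W\<^esub>" if "n \<in> ?N" for n
    using that by (auto simp: zero_def)
  then obtain \<psi> where \<psi>: "\<psi> \<in> linear_maps A (quot_module ?F ?N) W"
    "\<And>v. v \<in> carrier ?F \<Longrightarrow> \<psi> (?N +>\<^bsub>?F\<^esub> v) = T v"
    by (rule quot_module_universal[OF F.module_axioms N(1) W T(1)]) (assumption | rule that)+
  show ?thesis
    by (rule that[of \<psi>]) (simp_all add: kaehler_def kaehler_d_def \<psi> T(2) e)
qed

text \<open>
  The elements \<open>da\<close> span the module of differentials, because they span the free module above it.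
\<close>

lemma kaehler_linear_eqI:
  assumes "cring A" "K \<subseteq> carrier A" and W: "module A W"
    and S: "S \<in> linear_maps A (kaehler K A) W" and T: "T \<in> linear_maps A (kaehler K A) W"
    and eq: "\<And>a. a \<in> carrier A \<Longrightarrow> S (kaehler_d K A a) = T (kaehler_d K A a)"
  shows "S = T"
proof (rule extensionalityI)
  show "S \<in> extensional (carrier (kaehler K A))" "T \<in> extensional (carrier (kaehler K A))"
    using linear_mapsD(4) S T by blast+
  fix w assume w: "w \<in> carrier (kaehler K A)"
  let ?F = "free_module A (carrier A)" and ?e = "free_gen A (carrier A)"
  let ?N = "submodule_gen A ?F (kaehler_relations K A)"
  have F: "module A ?F" by (rule free_module_module) fact
  note N = submodule_gen_submodule[OF F kaehler_relations_closed[OF assms(1,2)]]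
  note coset = quot_module_coset[OF F N(1)]
  interpret F: module A ?F by fact
  define \<pi> where "\<pi> = (\<lambda>v\<in>carrier ?F. ?N +>\<^bsub>?F\<^esub> v)"
  have \<pi>: "\<pi> \<in> linear_maps A ?F (kaehler K A)"
    unfolding \<pi>_def kaehler_def by (rule linear_mapsI) (simp_all add: coset)
  let ?E = "{v \<in> carrier ?F. (\<lambda>v\<in>carrier ?F. S (\<pi> v)) v = (\<lambda>v\<in>carrier ?F. T (\<pi> v)) v}"
  have E: "?E = carrier ?F"
  proof (rule free_module_spanned)
    show "cring A" by fact
    show "submodule ?E A ?F"
      by (rule equalizer_submodule[OF F W]) (rule linear_maps_compose[OF F \<pi>] S T)+
    fix a assume "a \<in> carrier A"
    then show "?e a \<in> ?E"
      using eq[of a] by (simp add: \<pi>_def free_gen_closed[OF assms(1)] kaehler_d_def)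
  qed
  have "S (\<pi> v) = T (\<pi> v)" if v: "v \<in> carrier ?F" for v
  proof -
    have "v \<in> ?E" unfolding E by (rule v)
    then show ?thesis using v by simp
  qed
  moreover obtain v where "v \<in> carrier ?F" "w = ?N +>\<^bsub>?F\<^esub> v"
    using w unfolding kaehler_def by (rule bexE[OF coset(4)])
  ultimately show "S w = T w" by (metis \<pi>_def restrict_apply')
qed


section \<open>Connections on retracts of free modules\<close>

definition entrywise :: "'i set \<Rightarrow> ('a \<Rightarrow> 'a) \<Rightarrow> ('i \<Rightarrow> 'a) \<Rightarrow> ('i \<Rightarrow> 'a)" where
  "entrywise S \<delta> v = (\<lambda>s\<in>S. \<delta> (v s))"

lemma Der_D:
  assumes "\<delta> \<in> carrier (Der K A)"
  shows "a \<in> carrier A \<Longrightarrow> \<delta> a \<in> carrier A"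
    and "a \<in> carrier A \<Longrightarrow> b \<in> carrier A \<Longrightarrow> \<delta> (a \<oplus>\<^bsub>A\<^esub> b) = \<delta> a \<oplus>\<^bsub>A\<^esub> \<delta> b"
    and "c \<in> K \<Longrightarrow> a \<in> carrier A \<Longrightarrow> \<delta> (c \<otimes>\<^bsub>A\<^esub> a) = c \<otimes>\<^bsub>A\<^esub> \<delta> a"
    and "a \<in> carrier A \<Longrightarrow> b \<in> carrier A \<Longrightarrow> \<delta> (a \<otimes>\<^bsub>A\<^esub> b) = a \<otimes>\<^bsub>A\<^esub> \<delta> b \<oplus>\<^bsub>A\<^esub> b \<otimes>\<^bsub>A\<^esub> \<delta> a"
  using assms unfolding Der_def by auto

lemma Der_simps:
  "(\<delta> \<oplus>\<^bsub>Der K A\<^esub> \<epsilon>) = (\<lambda>a\<in>carrier A. \<delta> a \<oplus>\<^bsub>A\<^esub> \<epsilon> a)"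
  "(b \<odot>\<^bsub>Der K A\<^esub> \<delta>) = (\<lambda>a\<in>carrier A. b \<otimes>\<^bsub>A\<^esub> \<delta> a)"
  by (simp_all add: Der_def)

lemma Endo_simps:
  "carrier (Endo K A W) = linear_maps (A\<lparr>carrier := K\<rparr>) W W"
  "(f \<oplus>\<^bsub>Endo K A W\<^esub> g) = (\<lambda>w\<in>carrier W. f w \<oplus>\<^bsub>W\<^esub> g w)"
  "(b \<odot>\<^bsub>Endo K A W\<^esub> f) = (\<lambda>w\<in>carrier W. b \<odot>\<^bsub>W\<^esub> f w)"
  by (simp_all add: Endo_def)

lemma Der_module_closed:
  assumes "cring A" "K \<subseteq> carrier A" "\<delta> \<in> carrier (Der K A)"
  shows "\<epsilon> \<in> carrier (Der K A) \<Longrightarrow> \<delta> \<oplus>\<^bsub>Der K A\<^esub> \<epsilon> \<in> carrier (Der K A)"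
    and "b \<in> carrier A \<Longrightarrow> b \<odot>\<^bsub>Der K A\<^esub> \<delta> \<in> carrier (Der K A)"
proof -
  interpret A: cring A by fact
  note \<delta> = Der_D[OF assms(3)]
  have K: "c \<in> carrier A" if "c \<in> K" for c using that assms(2) by blast
  show "\<delta> \<oplus>\<^bsub>Der K A\<^esub> \<epsilon> \<in> carrier (Der K A)" if \<epsilon>: "\<epsilon> \<in> carrier (Der K A)"
  proof -
    note \<epsilon> = Der_D[OF \<epsilon>]
    have "(\<lambda>a\<in>carrier A. \<delta> a \<oplus>\<^bsub>A\<^esub> \<epsilon> a) \<in> carrier (Der K A)"
      unfolding Der_def partial_object.simps mem_Collect_eq
    proof (intro conjI ballI)
      fix a b assume ab: "a \<in> carrier A" "b \<in> carrier A"
      then have c: "\<delta> a \<in> carrier A" "\<delta> b \<in> carrier A" "\<epsilon> a \<in> carrier A" "\<epsilon> b \<in> carrier A"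
        by (simp_all add: \<delta> \<epsilon>)
      show "(\<lambda>a\<in>carrier A. \<delta> a \<oplus>\<^bsub>A\<^esub> \<epsilon> a) (a \<oplus>\<^bsub>A\<^esub> b) =
          (\<lambda>a\<in>carrier A. \<delta> a \<oplus>\<^bsub>A\<^esub> \<epsilon> a) a \<oplus>\<^bsub>A\<^esub> (\<lambda>a\<in>carrier A. \<delta> a \<oplus>\<^bsub>A\<^esub> \<epsilon> a) b"
        using ab c by (simp add: \<delta> \<epsilon> A.a_ac)
      show "(\<lambda>a\<in>carrier A. \<delta> a \<oplus>\<^bsub>A\<^esub> \<epsilon> a) (a \<otimes>\<^bsub>A\<^esub> b) =
          a \<otimes>\<^bsub>A\<^esub> (\<lambda>a\<in>carrier A. \<delta> a \<oplus>\<^bsub>A\<^esub> \<epsilon> a) b \<oplus>\<^bsub>A\<^esub> b \<otimes>\<^bsub>A\<^esub> (\<lambda>a\<in>carrier A. \<delta> a \<oplus>\<^bsub>A\<^esub> \<epsilon> a) a"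
        using ab c by (simp add: \<delta> \<epsilon> A.r_distr A.a_ac)
    qed (auto simp: \<delta> \<epsilon> K A.r_distr)
    then show ?thesis by (simp add: Der_simps)
  qed
  show "b \<odot>\<^bsub>Der K A\<^esub> \<delta> \<in> carrier (Der K A)" if b: "b \<in> carrier A"
  proof -
    have "(\<lambda>a\<in>carrier A. b \<otimes>\<^bsub>A\<^esub> \<delta> a) \<in> carrier (Der K A)"
      unfolding Der_def partial_object.simps mem_Collect_eq
    proof (intro conjI ballI)
      fix a c assume "a \<in> carrier A" "c \<in> carrier A"
      then show "(\<lambda>a\<in>carrier A. b \<otimes>\<^bsub>A\<^esub> \<delta> a) (a \<otimes>\<^bsub>A\<^esub> c) =
          a \<otimes>\<^bsub>A\<^esub> (\<lambda>a\<in>carrier A. b \<otimes>\<^bsub>A\<^esub> \<delta> a) c \<oplus>\<^bsub>A\<^esub> c \<otimes>\<^bsub>A\<^esub> (\<lambda>a\<in>carrier A. b \<otimes>\<^bsub>A\<^esub> \<delta> a) a"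
        using b by (simp add: \<delta> A.r_distr A.m_lcomm)
    qed (auto simp: \<delta> b K A.r_distr A.m_lcomm)
    then show ?thesis by (simp add: Der_simps)
  qed
qed

text \<open>
  A free module carries the connection that differentiates entry by entry, and a direct summand
  inherits it: if \<open>\<phi> \<circ> \<psi> = id\<close>, then \<open>\<phi> \<circ> \<delta> \<circ> \<psi>\<close> satisfies the Leibniz rule, since the extra term is
  \<open>\<phi> (\<delta> a \<psi> w) = \<delta> a w\<close>. This is the Grassmann connection of a projective module with a chosen
  embedding into a free one.
\<close>

lemma connection_of_retract:
  assumes "cring A" "K \<subseteq> carrier A" and W: "module A W" and "finite S"
    and \<phi>: "\<phi> \<in> linear_maps A (free_module A S) W" and \<psi>: "\<psi> \<in> linear_maps A W (free_module A S)"
    and retract: "\<And>w. w \<in> carrier W \<Longrightarrow> \<phi> (\<psi> w) = w"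
  shows "(\<lambda>\<delta>\<in>carrier (Der K A). \<lambda>w\<in>carrier W. \<phi> (entrywise S \<delta> (\<psi> w))) \<in> connections K A W"
proof -
  interpret A: cring A by fact
  interpret F: module A "free_module A S" by (rule free_module_module) fact
  interpret W: module A W by fact
  note \<phi> = linear_mapsD[OF \<phi>] and \<psi> = linear_mapsD[OF \<psi>]
  have K: "c \<in> carrier A" if "c \<in> K" for c using that assms(2) by blast
  have val: "v s \<in> carrier A" if "v \<in> carrier (free_module A S)" "s \<in> S" for v s
    using that by (auto simp: free_module_simps)
  have entry: "entrywise S \<delta> v \<in> carrier (free_module A S)"
    if "\<delta> \<in> carrier (Der K A)" "v \<in> carrier (free_module A S)" for \<delta> v
    using val[OF that(2)] Der_D(1)[OF that(1)] \<open>finite S\<close> by (auto simp: entrywise_def free_module_simps)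
  define nabla where "nabla \<delta> w = \<phi> (entrywise S \<delta> (\<psi> w))" for \<delta> w
  have closed: "nabla \<delta> w \<in> carrier W" if "\<delta> \<in> carrier (Der K A)" "w \<in> carrier W" for \<delta> w
    unfolding nabla_def using that by (simp add: \<phi> \<psi> entry)
  have add: "nabla \<delta> (v \<oplus>\<^bsub>W\<^esub> w) = nabla \<delta> v \<oplus>\<^bsub>W\<^esub> nabla \<delta> w"
    if \<delta>: "\<delta> \<in> carrier (Der K A)" and vw: "v \<in> carrier W" "w \<in> carrier W" for \<delta> v w
  proof -
    have "entrywise S \<delta> (\<psi> (v \<oplus>\<^bsub>W\<^esub> w)) =
        entrywise S \<delta> (\<psi> v) \<oplus>\<^bsub>free_module A S\<^esub> entrywise S \<delta> (\<psi> w)"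
      unfolding \<psi>(2)[OF vw] entrywise_def free_module_simps(3)
      by (rule restrict_ext) (simp add: Der_D[OF \<delta>] val[OF \<psi>(1)] vw)
    then show ?thesis using \<delta> vw by (simp add: nabla_def \<phi> \<psi>(1) entry)
  qed
  have smult: "nabla \<delta> (c \<odot>\<^bsub>W\<^esub> w) = c \<odot>\<^bsub>W\<^esub> nabla \<delta> w"
    if \<delta>: "\<delta> \<in> carrier (Der K A)" and cw: "c \<in> K" "w \<in> carrier W" for \<delta> c w
  proof -
    have "entrywise S \<delta> (\<psi> (c \<odot>\<^bsub>W\<^esub> w)) = c \<odot>\<^bsub>free_module A S\<^esub> entrywise S \<delta> (\<psi> w)"
      unfolding \<psi>(3)[OF K[OF cw(1)] cw(2)] entrywise_def free_module_simps(4)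
      by (rule restrict_ext) (simp add: Der_D[OF \<delta>] val[OF \<psi>(1)] cw)
    then show ?thesis using \<delta> cw by (simp add: nabla_def \<phi> \<psi>(1) entry K)
  qed
  have leibniz: "nabla \<delta> (a \<odot>\<^bsub>W\<^esub> w) = a \<odot>\<^bsub>W\<^esub> nabla \<delta> w \<oplus>\<^bsub>W\<^esub> \<delta> a \<odot>\<^bsub>W\<^esub> w"
    if \<delta>: "\<delta> \<in> carrier (Der K A)" and aw: "a \<in> carrier A" "w \<in> carrier W" for \<delta> a w
  proof -
    have "entrywise S \<delta> (\<psi> (a \<odot>\<^bsub>W\<^esub> w)) =
        a \<odot>\<^bsub>free_module A S\<^esub> entrywise S \<delta> (\<psi> w) \<oplus>\<^bsub>free_module A S\<^esub> \<delta> a \<odot>\<^bsub>free_module A S\<^esub> \<psi> w"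
      unfolding \<psi>(3)[OF aw] entrywise_def free_module_simps(3,4)
      by (rule restrict_ext) (simp add: Der_D[OF \<delta>] val[OF \<psi>(1)] aw A.m_comm)
    then show ?thesis using \<delta> aw by (simp add: nabla_def \<phi> \<psi>(1) entry Der_D(1) retract)
  qed
  have der_add: "nabla (\<delta> \<oplus>\<^bsub>Der K A\<^esub> \<epsilon>) w = nabla \<delta> w \<oplus>\<^bsub>W\<^esub> nabla \<epsilon> w"
    if \<delta>: "\<delta> \<in> carrier (Der K A)" and \<epsilon>: "\<epsilon> \<in> carrier (Der K A)" and w: "w \<in> carrier W" for \<delta> \<epsilon> w
  proof -
    have "entrywise S (\<delta> \<oplus>\<^bsub>Der K A\<^esub> \<epsilon>) (\<psi> w) =
        entrywise S \<delta> (\<psi> w) \<oplus>\<^bsub>free_module A S\<^esub> entrywise S \<epsilon> (\<psi> w)"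
      unfolding entrywise_def free_module_simps(3) Der_simps
      by (rule restrict_ext) (simp add: val[OF \<psi>(1)] w)
    then show ?thesis using \<delta> \<epsilon> w by (simp add: nabla_def \<phi> \<psi>(1) entry)
  qed
  have der_smult: "nabla (b \<odot>\<^bsub>Der K A\<^esub> \<delta>) w = b \<odot>\<^bsub>W\<^esub> nabla \<delta> w"
    if \<delta>: "\<delta> \<in> carrier (Der K A)" and b: "b \<in> carrier A" and w: "w \<in> carrier W" for \<delta> b w
  proof -
    have "entrywise S (b \<odot>\<^bsub>Der K A\<^esub> \<delta>) (\<psi> w) = b \<odot>\<^bsub>free_module A S\<^esub> entrywise S \<delta> (\<psi> w)"
      unfolding entrywise_def free_module_simps(4) Der_simps
      by (rule restrict_ext) (simp add: val[OF \<psi>(1)] w)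
    then show ?thesis using \<delta> b w by (simp add: nabla_def \<phi> \<psi>(1) entry)
  qed
  have endo: "restrict (nabla \<delta>) (carrier W) \<in> carrier (Endo K A W)" if "\<delta> \<in> carrier (Der K A)" for \<delta>
    unfolding Endo_simps by (rule linear_mapsI) (simp_all add: that closed add smult K)
  have "(\<lambda>\<delta>\<in>carrier (Der K A). restrict (nabla \<delta>) (carrier W)) \<in> linear_maps A (Der K A) (Endo K A W)"
  proof (rule linear_mapsI)
    fix \<delta> \<epsilon> assume "\<delta> \<in> carrier (Der K A)" "\<epsilon> \<in> carrier (Der K A)"
    then show "restrict (nabla (\<delta> \<oplus>\<^bsub>Der K A\<^esub> \<epsilon>)) (carrier W) =
        restrict (nabla \<delta>) (carrier W) \<oplus>\<^bsub>Endo K A W\<^esub> restrict (nabla \<epsilon>) (carrier W)"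
      unfolding Endo_simps by (intro restrict_ext) (simp add: der_add)
  next
    fix b \<delta> assume "b \<in> carrier A" "\<delta> \<in> carrier (Der K A)"
    then show "restrict (nabla (b \<odot>\<^bsub>Der K A\<^esub> \<delta>)) (carrier W) =
        b \<odot>\<^bsub>Endo K A W\<^esub> restrict (nabla \<delta>) (carrier W)"
      unfolding Endo_simps by (intro restrict_ext) (simp add: der_smult)
  qed (simp_all add: endo Der_module_closed assms)
  then show ?thesis
    unfolding connections_def nabla_def[symmetric] by (simp add: leibniz)
qed


section \<open>Derivations of the coordinate ring\<close>

lemma f_ideal_ideal: "ideal (f_ideal p q r) ring_of_type_algebra"
  unfolding f_ideal_def
  by (rule cring.cgenideal_ideal[OF cring_from_type_algebra]) (simp add: ring_of_type_algebra_def)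

lemma coord_ring_cring: "cring (coord_ring p q r)"
  unfolding coord_ring_def
  by (rule ideal.quotient_is_cring[OF f_ideal_ideal cring_from_type_algebra])

lemma cls_hom:
  fixes g h :: "'k::field_char_0 poly3"
  shows "cls p q r (g + h) = cls p q r g \<oplus>\<^bsub>coord_ring p q r\<^esub> cls p q r h"
  "cls p q r (g * h) = cls p q r g \<otimes>\<^bsub>coord_ring p q r\<^esub> cls p q r h"
  "cls p q r (1 :: 'k poly3) = \<one>\<^bsub>coord_ring p q r\<^esub>"
  "cls p q r (0 :: 'k poly3) = \<zero>\<^bsub>coord_ring p q r\<^esub>"
proof -
  let ?P = "ring_of_type_algebra :: 'k poly3 ring"
  have hom: "cls p q r \<in> ring_hom ?P (coord_ring p q r)"
    using ideal.rcos_ring_hom[OF f_ideal_ideal[of p q r]] unfolding coord_ring_def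
    by (simp add: cls_def[abs_def])
  have UNIV: "u \<in> carrier ?P" for u by (simp add: ring_of_type_algebra_def)
  show "cls p q r (g + h) = cls p q r g \<oplus>\<^bsub>coord_ring p q r\<^esub> cls p q r h"
    using ring_hom_add[OF hom UNIV UNIV, of g h] by (simp add: ring_of_type_algebra_def)
  show "cls p q r (g * h) = cls p q r g \<otimes>\<^bsub>coord_ring p q r\<^esub> cls p q r h"
    using ring_hom_mult[OF hom UNIV UNIV, of g h] by (simp add: ring_of_type_algebra_def)
  show "cls p q r (1 :: 'k poly3) = \<one>\<^bsub>coord_ring p q r\<^esub>"
    using ring_hom_one[OF hom] by (simp add: ring_of_type_algebra_def)
  show "cls p q r (0 :: 'k poly3) = \<zero>\<^bsub>coord_ring p q r\<^esub>"
    using ring_hom_zero[OF hom cring.axioms(1)[OF cring_from_type_algebra] cring.axioms(1)[OF coord_ring_cring]]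
    by (simp add: ring_of_type_algebra_def)
qed

lemma coord_ring_cases:
  assumes "a \<in> carrier (coord_ring p q r)"
  obtains g where "a = cls p q r g"
  using assms unfolding coord_ring_def FactRing_def A_RCOSETS_def' cls_def by auto

lemma scalars_subset: "scalars p q r \<subseteq> carrier (coord_ring p q r)"
  unfolding scalars_def using cls_in_carrier by blast

lemma const3_hom:
  "const3 (a + b) = const3 a + const3 b"
  "const3 (a * b) = const3 a * const3 b"
  "const3 0 = 0" "const3 1 = 1"
  by (simp_all add: const3_def one_pCons)

lemma of_nat_const3: "of_nat n = const3 (of_nat n)"
  by (induction n) (simp_all add: const3_hom)

text \<open>
  Derivations over \<open>k\<close> of the polynomial ring itself. Computing with them upstairs and passing to
  classes at the end replaces calculations in the quotient ring by polynomial identities.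
\<close>

definition derivation3 :: "('k::field_char_0 poly3 \<Rightarrow> 'k poly3) \<Rightarrow> bool" where
  "derivation3 D \<longleftrightarrow>
     (\<forall>u v. D (u + v) = D u + D v) \<and> (\<forall>u v. D (u * v) = u * D v + v * D u) \<and>
     (\<forall>c. D (const3 c) = 0)"

lemma derivation3D:
  assumes "derivation3 D"
  shows "D (u + v) = D u + D v" "D (u * v) = u * D v + v * D u" "D (const3 c) = 0"
    "D 0 = 0" "D 1 = 0" "D (- u) = - D u" "D (u - v) = D u - D v"
proof -
  show add: "D (u + v) = D u + D v" and "D (u * v) = u * D v + v * D u" and c: "D (const3 c) = 0"
    for u v c using assms unfolding derivation3_def by blast+
  show zero: "D 0 = 0" and "D 1 = 0" using c[of 0] c[of 1] by (simp_all add: const3_hom)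
  show minus: "D (- u) = - D u" for u using add[of u "- u"] zero by (simp add: add_eq_0_iff)
  show "D (u - v) = D u - D v" using add[of u "- v"] minus by simp
qed

lemma derivation3_add: "derivation3 D \<Longrightarrow> derivation3 E \<Longrightarrow> derivation3 (\<lambda>g. D g + E g)"
  and derivation3_diff: "derivation3 D \<Longrightarrow> derivation3 E \<Longrightarrow> derivation3 (\<lambda>g. D g - E g)"
  and derivation3_smult: "derivation3 D \<Longrightarrow> derivation3 (\<lambda>g. h * D g)"
  unfolding derivation3_def by (simp_all add: algebra_simps)

lemma derivation3_partial: "derivation3 partial_x" "derivation3 partial_y" "derivation3 partial_z"
  unfolding derivation3_def
  by (simp_all add: partial_add partial_mult)
    (simp_all add: const3_def partial_x_def partial_y_def partial_z_def map_poly_pCons pderiv_pCons)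

lemma derivation3_tangent:
  "derivation3 (partial_1 p q)" "derivation3 (partial_2 p r)" "derivation3 (partial_3 q r)"
  unfolding partial_1_def[abs_def] partial_2_def[abs_def] partial_3_def[abs_def]
  by (intro derivation3_diff derivation3_smult derivation3_partial)+

text \<open>
  The product rule makes \<open>D (f m) = f D m + m D f\<close> a multiple of \<open>f\<close> as soon as \<open>D f\<close> is one, so \<open>D\<close>
  respects congruence modulo \<open>f\<close>. Divisibility of \<open>D f\<close> is asked for instead of \<open>D f = 0\<close> because the
  components of the projected gradient below satisfy only the former.
\<close>

lemma descend_derivation:
  fixes D :: "'k::field_char_0 poly3 \<Rightarrow> 'k poly3"
  assumes D: "derivation3 D" and f: "f_poly p q r dvd D (f_poly p q r)"
  shows "descend p q r D (cls p q r g) = cls p q r (D g)"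
    and "descend p q r D \<in> carrier (Der (scalars p q r) (coord_ring p q r))"
proof -
  have desc: "descend p q r D (cls p q r g) = cls p q r (D g)" for g
  proof (rule descend_cls)
    fix g h :: "'k poly3"
    assume "f_poly p q r dvd g - h"
    then obtain m where "g - h = f_poly p q r * m" ..
    then have "D g - D h = f_poly p q r * D m + m * D (f_poly p q r)"
      by (metis derivation3D(2,7)[OF D])
    then show "f_poly p q r dvd D g - D h" using f by simp
  qed
  then show "descend p q r D (cls p q r g) = cls p q r (D g)" .
  show "descend p q r D \<in> carrier (Der (scalars p q r) (coord_ring p q r))"
    unfolding Der_def partial_object.simps mem_Collect_eq
  proof (intro conjI ballI)
    show "descend p q r D \<in> carrier (coord_ring p q r) \<rightarrow>\<^sub>E carrier (coord_ring p q r)"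
    proof (rule PiE_I)
      fix a :: "'k poly3 set" assume "a \<in> carrier (coord_ring p q r)"
      then show "descend p q r D a \<in> carrier (coord_ring p q r)"
        by (rule coord_ring_cases) (simp add: desc cls_in_carrier)
    qed (simp add: descend_def)
  next
    fix a b :: "'k poly3 set"
    assume "a \<in> carrier (coord_ring p q r)" "b \<in> carrier (coord_ring p q r)"
    then obtain g h where gh: "a = cls p q r g" "b = cls p q r h" by (elim coord_ring_cases)
    show "descend p q r D (a \<oplus>\<^bsub>coord_ring p q r\<^esub> b) =
        descend p q r D a \<oplus>\<^bsub>coord_ring p q r\<^esub> descend p q r D b"
      unfolding gh cls_hom(1)[symmetric] desc by (simp add: derivation3D(1)[OF D])
    show "descend p q r D (a \<otimes>\<^bsub>coord_ring p q r\<^esub> b) =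
        a \<otimes>\<^bsub>coord_ring p q r\<^esub> descend p q r D b \<oplus>\<^bsub>coord_ring p q r\<^esub>
          b \<otimes>\<^bsub>coord_ring p q r\<^esub> descend p q r D a"
      unfolding gh desc cls_hom(2)[symmetric] cls_hom(1)[symmetric]
      by (simp add: derivation3D(2)[OF D])
  next
    fix c a :: "'k poly3 set"
    assume "c \<in> scalars p q r" "a \<in> carrier (coord_ring p q r)"
    then obtain k g where "c = cls p q r (const3 k)" "a = cls p q r g"
      unfolding scalars_def by (elim coord_ring_cases rangeE)
    then show "descend p q r D (c \<otimes>\<^bsub>coord_ring p q r\<^esub> a) = c \<otimes>\<^bsub>coord_ring p q r\<^esub> descend p q r D a"
      by (simp add: cls_hom(2)[symmetric] desc derivation3D[OF D])
  qed
qed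

lemma der_gens_cases:
  assumes "\<delta> \<in> der_gens p q r"
  obtains D where "derivation3 D" "f_poly p q r dvd D (f_poly p q r)" "\<delta> = descend p q r D"
proof -
  have f: "partial_1 p q (f_poly p q r) = 0" "partial_2 p r (f_poly p q r) = 0"
    "partial_3 q r (f_poly p q r) = 0"
    by (simp_all add: partial_1_def partial_2_def partial_3_def partial_f_poly algebra_simps)
  from assms consider "\<delta> = descend p q r (partial_1 p q)" | "\<delta> = descend p q r (partial_2 p r)"
    | "\<delta> = descend p q r (partial_3 q r)" unfolding der_gens_def by blast
  then show ?thesis
    by cases (rule that[rotated 2], assumption, rule derivation3_tangent, simp only: f dvd_0_right)+
qed

text \<open>
  Used to check identities between derivations on constants and variables only.
\<close>

lemma poly3_induct [case_names const x y z add mult]: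
  assumes const: "\<And>c. P (const3 c)" and x: "P var_x" and y: "P var_y" and z: "P var_z"
    and add: "\<And>g h. P g \<Longrightarrow> P h \<Longrightarrow> P (g + h)" and mult: "\<And>g h. P g \<Longrightarrow> P h \<Longrightarrow> P (g * h)"
  shows "P g"
proof -
  have zero: "P 0" using const[of 0] by (simp add: const3_hom)
  have 1: "P [:[:u:]:]" for u
  proof (induction u)
    case 0
    show ?case using zero by simp
  next
    case (pCons a u)
    have "[:[:pCons a u:]:] = const3 a + var_x * [:[:u:]:]" by (simp add: const3_def var_x_def)
    then show ?case using add[OF const mult[OF x pCons.IH]] by simp
  qed
  have 2: "P [:u:]" for u
  proof (induction u)
    case 0
    show ?case using zero by simp
  next
    case (pCons a u)
    have "[:pCons a u:] = [:[:a:]:] + var_y * [:u:]" by (simp add: var_y_def)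
    then show ?case using add[OF 1 mult[OF y pCons.IH]] by simp
  qed
  show ?thesis
  proof (induction g)
    case 0
    show ?case by (rule zero)
  next
    case (pCons a u)
    have "pCons a u = [:a:] + var_z * u" by (simp add: var_z_def)
    then show ?case using add[OF 2 mult[OF z pCons.IH]] by simp
  qed
qed


section \<open>The projection along \<open>dF\<close>\<close>

definition grad :: "'k::field_char_0 poly3 \<Rightarrow> nat \<Rightarrow> 'k poly3" where
  "grad g j = [partial_x g, partial_y g, partial_z g] ! j"

text \<open>
  The coefficients \<open>x/p, y/q, z/r\<close> of the Euler vector field for which \<open>x\<^sup>p\<close>, \<open>y\<^sup>q\<close> and \<open>z\<^sup>r\<close> all have
  weight one.
\<close>

definition euler :: "nat \<Rightarrow> nat \<Rightarrow> nat \<Rightarrow> nat \<Rightarrow> 'k::field_char_0 poly3" where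
  "euler p q r j = [const3 (1 / of_nat p) * var_x, const3 (1 / of_nat q) * var_y,
     const3 (1 / of_nat r) * var_z] ! j"

definition euler_pairing ::
    "nat \<Rightarrow> nat \<Rightarrow> nat \<Rightarrow> (nat \<Rightarrow> 'k::field_char_0 poly3) \<Rightarrow> 'k poly3" where
  "euler_pairing p q r g = (\<Sum>j\<in>{0, 1, 2}. euler p q r j * g j)"

text \<open>
  The action of the matrix \<open>M\<close>, written as \<open>v - \<langle>e, v\<rangle> dF\<close> with the Euler vector \<open>e\<close>.
\<close>

definition euler_projection ::
    "nat \<Rightarrow> nat \<Rightarrow> nat \<Rightarrow> (nat \<Rightarrow> 'k::field_char_0 poly3) \<Rightarrow> nat \<Rightarrow> 'k poly3" where
  "euler_projection p q r g i = g i - euler_pairing p q r g * grad (f_poly p q r) i"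

lemma grad_f: "grad (f_poly p q r) =
    (\<lambda>j. [of_nat p * var_x ^ (p - 1), of_nat q * var_y ^ (q - 1), of_nat r * var_z ^ (r - 1)] ! j)"
  by (simp add: grad_def fun_eq_iff partial_f_poly)

lemma of_nat_mult_const3_inverse:
  assumes "n \<ge> 1"
  shows "of_nat n * const3 (1 / of_nat n) = (1 :: 'k::field_char_0 poly3)"
  using assms by (simp add: of_nat_const3 const3_hom(2)[symmetric] const3_hom(4))

lemma euler_power:
  fixes v :: "'k::field_char_0 poly3"
  assumes "n \<ge> 1"
  shows "of_nat n * v ^ (n - 1) * (const3 (1 / of_nat n) * v) = v ^ n"
proof -
  have "of_nat n * v ^ (n - 1) * (const3 (1 / of_nat n) * v) =
      (of_nat n * const3 (1 / of_nat n)) * (v * v ^ (n - 1))" by (simp add: algebra_simps)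
  also have "\<dots> = v * v ^ (n - 1)"
    using assms by (simp add: of_nat_mult_const3_inverse)
  also have "\<dots> = v ^ n" using assms by (cases n) simp_all
  finally show ?thesis .
qed

text \<open>
  Euler's identity for \<open>f + 1 = x\<^sup>p + y\<^sup>q + z\<^sup>r\<close>. On the surface it reads \<open>\<langle>e, dF\<rangle> = 1\<close>, which is why
  the projection is idempotent with kernel \<open>A dF\<close>.
\<close>

lemma euler_pairing_grad_f:
  assumes "p \<ge> 1" "q \<ge> 1" "r \<ge> 1"
  shows "euler_pairing p q r (grad (f_poly p q r)) = f_poly p q r + (1 :: 'k::field_char_0 poly3)"
proof -
  have "euler_pairing p q r (grad (f_poly p q r)) = var_x ^ p + (var_y ^ q + (var_z ^ r :: 'k poly3))"
    unfolding euler_power[OF assms(1), of var_x, symmetric]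
      euler_power[OF assms(2), of var_y, symmetric] euler_power[OF assms(3), of var_z, symmetric]
    by (simp add: euler_pairing_def grad_f euler_def mult.commute)
  then show ?thesis by (simp add: f_poly_def)
qed

text \<open>
  The rank one form \<open>1 - dF e\<^sup>T\<close> of \<open>M\<close>: a fraction \<open>p/q\<close> in \<open>M\<close> is the factor \<open>p\<close> of \<open>dF\<close> times the
  factor \<open>1/q\<close> of \<open>e\<close>, and on the diagonal these cancel.
\<close>

lemma M_matrix_eq:
  assumes "p \<ge> 1" "q \<ge> 1" "r \<ge> 1" "i \<in> {0, 1, 2}" "j \<in> {0, 1, 2}"
  shows "M_matrix p q r i j =
    cls p q r ((if i = j then 1 else 0) - grad (f_poly p q r) i * euler p q r j)"
proof -
  have frac: "const3 (of_nat m / of_nat n) = of_nat m * const3 (1 / of_nat n)" for m n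
    by (simp add: of_nat_const3 const3_hom(2)[symmetric])
  note power = euler_power[OF assms(1), unfolded One_nat_def]
    euler_power[OF assms(2), unfolded One_nat_def] euler_power[OF assms(3), unfolded One_nat_def]
  show ?thesis
    using assms(4,5)
    by (auto simp: M_matrix_def Let_def grad_f euler_def power frac intro!: arg_cong[of _ _ "cls p q r"])
qed

lemma derivation3_grad: "derivation3 (\<lambda>g. grad g j)" if "j \<in> {0, 1, 2}"
  using that derivation3_partial by (auto simp: grad_def)

lemma derivation3_projection_grad:
  assumes "j \<in> {0, 1, 2}"
  shows "derivation3 (\<lambda>g. euler_projection p q r (grad g) j)"
  unfolding euler_projection_def euler_pairing_def mult.commute[of "sum _ _"]
  using assms by (auto intro!: derivation3_add derivation3_diff derivation3_smult derivation3_grad)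

text \<open>
  The projection annihilates multiples of \<open>dF\<close> modulo \<open>f\<close>, since
  \<open>a dF - \<langle>e, a dF\<rangle> dF = a (1 - (f + 1)) dF\<close>.
\<close>

lemma projection_multiple_grad_f:
  assumes "p \<ge> 1" "q \<ge> 1" "r \<ge> 1"
  shows "euler_projection p q r (\<lambda>j. a * grad (f_poly p q r) j) i = f_poly p q r * (- a * grad (f_poly p q r) i)"
proof -
  have "euler_pairing p q r (\<lambda>j. a * grad (f_poly p q r) j) =
      a * euler_pairing p q r (grad (f_poly p q r))"
    by (simp add: euler_pairing_def algebra_simps)
  then show ?thesis
    using assms by (simp add: euler_projection_def euler_pairing_grad_f algebra_simps)
qed

text \<open>
  The identity behind the operators. Differentiating \<open>M v = v - \<langle>e, v\<rangle> dF\<close> gives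
  \<open>D(M v) = D v - (\<langle>D e, v\<rangle> + \<langle>e, D v\<rangle>) dF - \<langle>e, v\<rangle> D(dF)\<close>, while
  \<open>D(M) v = - \<langle>e, v\<rangle> D(dF) - \<langle>D e, v\<rangle> dF\<close>; hence \<open>D v + D(M) v\<close> and \<open>D(M v)\<close> differ by the
  multiple \<open>\<langle>e, D v\<rangle>\<close> of \<open>dF\<close>.
\<close>

lemma derivation_of_projection:
  assumes D: "derivation3 D" and i: "i \<in> {0, 1, 2}"
  shows "D (g i) + (\<Sum>j\<in>{0, 1, 2}. D ((if i = j then 1 else 0) - grad (f_poly p q r) i * euler p q r j) * g j) =
    D (euler_projection p q r g i) + euler_pairing p q r (\<lambda>j. D (g j)) * grad (f_poly p q r) i"
  by (simp add: euler_projection_def euler_pairing_def derivation3D[OF D] if_distrib[of D] cong: if_cong)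
    (simp add: algebra_simps)


section \<open>The differentials of the surface\<close>

definition cls_vec ::
    "nat \<Rightarrow> nat \<Rightarrow> nat \<Rightarrow> (nat \<Rightarrow> 'k::field_char_0 poly3) \<Rightarrow> nat \<Rightarrow> 'k poly3 set" where
  "cls_vec p q r g = (\<lambda>j\<in>{0, 1, 2}. cls p q r (g j))"

lemma cls_vec_closed: "cls_vec p q r g \<in> carrier (A3 p q r)"
  by (auto simp: cls_vec_def A3_def free_module_simps cls_in_carrier)

lemma A3_cases:
  assumes "v \<in> carrier (A3 p q r)"
  obtains g where "v = cls_vec p q r g"
proof -
  have v: "v \<in> {0, 1, 2} \<rightarrow>\<^sub>E carrier (coord_ring p q r)"
    using assms by (simp add: A3_def free_module_simps)
  have "\<exists>h. v j = cls p q r h" if "j \<in> {0, 1, 2}" for j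
    using PiE_mem[OF v that] by (metis coord_ring_cases)
  then obtain g where "\<And>j. j \<in> {0, 1, 2} \<Longrightarrow> v j = cls p q r (g j)" by metis
  then have "v = cls_vec p q r g"
    unfolding cls_vec_def using v by (intro PiE_ext[OF v]) (auto simp: cls_in_carrier)
  then show ?thesis by (rule that)
qed

lemma cls_vec_simps:
  "cls_vec p q r g \<oplus>\<^bsub>A3 p q r\<^esub> cls_vec p q r h = cls_vec p q r (\<lambda>j. g j + h j)"
  "cls p q r a \<odot>\<^bsub>A3 p q r\<^esub> cls_vec p q r g = cls_vec p q r (\<lambda>j. a * g j)"
  "\<zero>\<^bsub>A3 p q r\<^esub> = cls_vec p q r (\<lambda>j. 0)"
  by (auto simp: cls_vec_def A3_def free_module_simps cls_hom intro!: restrict_ext)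

lemma cls_vec_eqI: "(\<And>j. j \<in> {0, 1, 2} \<Longrightarrow> f_poly p q r dvd g j - h j) \<Longrightarrow> cls_vec p q r g = cls_vec p q r h"
  unfolding cls_vec_def by (rule restrict_ext) (simp add: cls_eq_iff)

lemma dF_eq: "dF p q r = cls_vec p q r (grad (f_poly p q r))"
  by (simp add: dF_def cls_vec_def grad_f)

lemma A3_module: "module (coord_ring p q r) (A3 p q r)"
  unfolding A3_def by (rule free_module_module) (rule coord_ring_cring)

lemma entrywise_cls_vec:
  assumes "derivation3 D" "f_poly p q r dvd D (f_poly p q r)"
  shows "entrywise {0, 1, 2} (descend p q r D) (cls_vec p q r g) = cls_vec p q r (\<lambda>j. D (g j))"
  unfolding entrywise_def cls_vec_def by (rule restrict_ext) (simp add: descend_derivation[OF assms])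

lemma conn_op_cls_vec:
  assumes "p \<ge> 1" "q \<ge> 1" "r \<ge> 1" and D: "derivation3 D" "f_poly p q r dvd D (f_poly p q r)"
  shows "conn_op p q r (descend p q r D) (cls_vec p q r g) =
    entrywise {0, 1, 2} (descend p q r D) (cls_vec p q r (euler_projection p q r g)) \<oplus>\<^bsub>A3 p q r\<^esub>
      cls p q r (euler_pairing p q r (\<lambda>j. D (g j))) \<odot>\<^bsub>A3 p q r\<^esub> dF p q r"
proof -
  interpret A: cring "coord_ring p q r" by (rule coord_ring_cring)
  have "conn_op p q r (descend p q r D) (cls_vec p q r g) = cls_vec p q r (\<lambda>i. D (g i) +
      (\<Sum>j\<in>{0, 1, 2}. D ((if i = j then 1 else 0) - grad (f_poly p q r) i * euler p q r j) * g j))"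
    unfolding conn_op_def Let_def cls_vec_def
  proof (rule restrict_ext)
    fix i :: nat assume i: "i \<in> {0, 1, 2}"
    have entry: "descend p q r D (M_matrix p q r i j) =
        cls p q r (D ((if i = j then 1 else 0) - grad (f_poly p q r) i * euler p q r j))"
      if "j \<in> {0, 1, 2}" for j
      by (simp only: M_matrix_eq[OF assms(1-3) i that] descend_derivation[OF D])
    show "descend p q r D ((\<lambda>j\<in>{0, 1, 2}. cls p q r (g j)) i) \<oplus>\<^bsub>coord_ring p q r\<^esub>
        (\<Oplus>\<^bsub>coord_ring p q r\<^esub>j\<in>{0, 1, 2}. descend p q r D (M_matrix p q r i j) \<otimes>\<^bsub>coord_ring p q r\<^esub>
           (\<lambda>j\<in>{0, 1, 2}. cls p q r (g j)) j) =
      cls p q r (D (g i) +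
        (\<Sum>j\<in>{0, 1, 2}. D ((if i = j then 1 else 0) - grad (f_poly p q r) i * euler p q r j) * g j))"
      using i by (simp add: entry descend_derivation[OF D] cls_in_carrier cls_hom(1,2))
  qed
  also have "\<dots> = cls_vec p q r (\<lambda>i. D (euler_projection p q r g i) +
      euler_pairing p q r (\<lambda>j. D (g j)) * grad (f_poly p q r) i)"
    unfolding cls_vec_def by (rule restrict_ext) (simp only: derivation_of_projection[OF D(1)])
  finally show ?thesis by (simp only: dF_eq cls_vec_simps entrywise_cls_vec[OF D])
qed

text \<open>
  By the previous formula, up to a multiple of \<open>dF\<close> the operator differentiates the projection of its
  argument, and the projection of a multiple of \<open>dF\<close> is zero.
\<close>

lemma conn_op_preserves_A_dF:
  assumes "p \<ge> 1" "q \<ge> 1" "r \<ge> 1" and D: "derivation3 D" "f_poly p q r dvd D (f_poly p q r)"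
    and "v \<in> A_dF p q r"
  shows "conn_op p q r (descend p q r D) v \<in> A_dF p q r"
proof -
  interpret A3: module "coord_ring p q r" "A3 p q r" by (rule A3_module)
  obtain a where v: "v = cls_vec p q r (\<lambda>j. a * grad (f_poly p q r) j)"
    using assms(6) unfolding A_dF_def dF_eq by (auto simp: cls_vec_simps elim!: coord_ring_cases)
  have "entrywise {0, 1, 2} (descend p q r D) (cls_vec p q r (euler_projection p q r (\<lambda>j. a * grad (f_poly p q r) j))) =
      \<zero>\<^bsub>A3 p q r\<^esub>"
    unfolding entrywise_cls_vec[OF D] cls_vec_simps projection_multiple_grad_f[OF assms(1-3)]
    by (rule cls_vec_eqI) (simp add: derivation3D[OF D(1)] D(2))
  then have "conn_op p q r (descend p q r D) v =
      cls p q r (euler_pairing p q r (\<lambda>j. D (a * grad (f_poly p q r) j))) \<odot>\<^bsub>A3 p q r\<^esub> dF p q r"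
    unfolding v conn_op_cls_vec[OF assms(1-5)]
    by (simp add: cls_vec_closed cls_in_carrier dF_eq)
  then show ?thesis unfolding A_dF_def using cls_in_carrier by blast
qed

lemma to_Omega_eq:
  fixes p q r :: nat and v :: "nat \<Rightarrow> 'k::field_char_0 poly3 set"
  defines "\<Omega> \<equiv> kaehler (scalars p q r) (coord_ring p q r)"
    and "d \<equiv> \<lambda>g. kaehler_d (scalars p q r) (coord_ring p q r) (cls p q r g)"
  assumes "v \<in> carrier (A3 p q r)"
  shows "to_Omega p q r v =
    v 0 \<odot>\<^bsub>\<Omega>\<^esub> d var_x \<oplus>\<^bsub>\<Omega>\<^esub> (v 1 \<odot>\<^bsub>\<Omega>\<^esub> d var_y \<oplus>\<^bsub>\<Omega>\<^esub> v 2 \<odot>\<^bsub>\<Omega>\<^esub> d var_z)"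
proof -
  interpret W: module "coord_ring p q r" \<Omega>
    unfolding \<Omega>_def by (rule kaehler_module[OF coord_ring_cring scalars_subset])
  have d: "kaehler_d (scalars p q r) (coord_ring p q r) (cls p q r g) \<in> carrier \<Omega>" for g
    unfolding \<Omega>_def
    by (rule derivation_intoD(1)[OF kaehler_d_derivation[OF coord_ring_cring scalars_subset] cls_in_carrier])
  have "v j \<in> carrier (coord_ring p q r)" if "j \<in> {0, 1, 2}" for j
    using assms(3) that unfolding A3_def free_module_simps by blast
  then show ?thesis
    unfolding to_Omega_def Let_def \<Omega>_def[symmetric] d_def by (simp add: d)
qed

lemma to_Omega_hom:
  fixes p q r :: nat and v w :: "nat \<Rightarrow> 'k::field_char_0 poly3 set"
  defines "\<Omega> \<equiv> kaehler (scalars p q r) (coord_ring p q r)"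
  assumes v: "v \<in> carrier (A3 p q r)"
  shows "to_Omega p q r v \<in> carrier \<Omega>"
    and "w \<in> carrier (A3 p q r) \<Longrightarrow>
      to_Omega p q r (v \<oplus>\<^bsub>A3 p q r\<^esub> w) = to_Omega p q r v \<oplus>\<^bsub>\<Omega>\<^esub> to_Omega p q r w"
    and "a \<in> carrier (coord_ring p q r) \<Longrightarrow>
      to_Omega p q r (a \<odot>\<^bsub>A3 p q r\<^esub> v) = a \<odot>\<^bsub>\<Omega>\<^esub> to_Omega p q r v"
proof -
  interpret A3: module "coord_ring p q r" "A3 p q r :: (_, nat \<Rightarrow> 'k poly3 set) module"
    by (rule A3_module)
  interpret W: module "coord_ring p q r" \<Omega>
    unfolding \<Omega>_def by (rule kaehler_module[OF coord_ring_cring scalars_subset])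
  have d: "kaehler_d (scalars p q r) (coord_ring p q r) (cls p q r g) \<in> carrier \<Omega>" for g
    unfolding \<Omega>_def
    by (rule derivation_intoD(1)[OF kaehler_d_derivation[OF coord_ring_cring scalars_subset] cls_in_carrier])
  have val: "u j \<in> carrier (coord_ring p q r)" if "u \<in> carrier (A3 p q r)" "j \<in> {0, 1, 2}"
    for u :: "nat \<Rightarrow> 'k poly3 set" and j
    using that unfolding A3_def free_module_simps by blast
  have val: "u 0 \<in> carrier (coord_ring p q r)" "u 1 \<in> carrier (coord_ring p q r)"
    "u 2 \<in> carrier (coord_ring p q r)" if "u \<in> carrier (A3 p q r)" for u :: "nat \<Rightarrow> 'k poly3 set"
    using val[OF that] by simp_all
  have entries: "(u \<oplus>\<^bsub>A3 p q r\<^esub> u') j = u j \<oplus>\<^bsub>coord_ring p q r\<^esub> u' j"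
    "(a \<odot>\<^bsub>A3 p q r\<^esub> u) j = a \<otimes>\<^bsub>coord_ring p q r\<^esub> u j" if "j \<in> {0, 1, 2}"
    for u u' :: "nat \<Rightarrow> 'k poly3 set" and a j
    using that by (auto simp: A3_def free_module_simps)
  show "to_Omega p q r v \<in> carrier \<Omega>"
    unfolding to_Omega_eq[OF v] \<Omega>_def[symmetric] by (intro W.M.a_closed W.smult_closed val v d)
  show "to_Omega p q r (v \<oplus>\<^bsub>A3 p q r\<^esub> w) = to_Omega p q r v \<oplus>\<^bsub>\<Omega>\<^esub> to_Omega p q r w"
    if w: "w \<in> carrier (A3 p q r)"
    unfolding to_Omega_eq[OF v] to_Omega_eq[OF w] to_Omega_eq[OF A3.M.a_closed[OF v w]] \<Omega>_def[symmetric]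
    using val[OF v] val[OF w] d by (simp add: entries W.smult_l_distr W.M.a_ac)
  show "to_Omega p q r (a \<odot>\<^bsub>A3 p q r\<^esub> v) = a \<odot>\<^bsub>\<Omega>\<^esub> to_Omega p q r v"
    if a: "a \<in> carrier (coord_ring p q r)"
    unfolding to_Omega_eq[OF v] to_Omega_eq[OF A3.smult_closed[OF a v]] \<Omega>_def[symmetric]
    using val[OF v] d a by (simp add: entries W.smult_r_distr W.smult_assoc1)
qed

lemma to_Omega_linear:
  "restrict (to_Omega p q r) (carrier (A3 p q r)) \<in>
    linear_maps (coord_ring p q r) (A3 p q r) (kaehler (scalars p q r) (coord_ring p q r))"
proof -
  interpret A3: module "coord_ring p q r" "A3 p q r" by (rule A3_module)
  show ?thesis by (rule linear_mapsI) (simp_all add: to_Omega_hom)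
qed

text \<open>
  The chain rule \<open>dg = g\<^sub>x dx + g\<^sub>y dy + g\<^sub>z dz\<close>: both sides are derivations in \<open>g\<close> and agree on constants
  and variables.
\<close>

lemma to_Omega_grad:
  "to_Omega p q r (cls_vec p q r (grad g)) = kaehler_d (scalars p q r) (coord_ring p q r) (cls p q r g)"
proof -
  interpret A3: module "coord_ring p q r" "A3 p q r" by (rule A3_module)
  interpret W: module "coord_ring p q r" "kaehler (scalars p q r) (coord_ring p q r)"
    by (rule kaehler_module[OF coord_ring_cring scalars_subset])
  note d = derivation_intoD[OF kaehler_d_derivation[OF coord_ring_cring scalars_subset[of p q r]]]
  have add: "cls_vec p q r (grad (g + h)) = cls_vec p q r (grad g) \<oplus>\<^bsub>A3 p q r\<^esub> cls_vec p q r (grad h)" for g h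
    unfolding cls_vec_simps by (rule cls_vec_eqI) (auto simp: grad_def partial_add)
  have mult: "cls_vec p q r (grad (g * h)) = cls p q r g \<odot>\<^bsub>A3 p q r\<^esub> cls_vec p q r (grad h)
      \<oplus>\<^bsub>A3 p q r\<^esub> cls p q r h \<odot>\<^bsub>A3 p q r\<^esub> cls_vec p q r (grad g)" for g h
    unfolding cls_vec_simps by (rule cls_vec_eqI) (auto simp: grad_def partial_mult)
  have vars: "to_Omega p q r (cls_vec p q r (grad v)) =
      kaehler_d (scalars p q r) (coord_ring p q r) (cls p q r v)"
    if "v \<in> {var_x, var_y, var_z}" for v
    using that unfolding to_Omega_eq[OF cls_vec_closed]
    by (auto simp: cls_vec_def grad_def partial_vars cls_hom(3,4) d cls_in_carrier)
  show ?thesis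
  proof (induction g rule: poly3_induct)
    case (const c)
    have "cls_vec p q r (grad (const3 c)) = \<zero>\<^bsub>A3 p q r\<^esub>"
      unfolding cls_vec_simps
      by (rule cls_vec_eqI) (auto simp: grad_def derivation3D[OF derivation3_partial(1)]
          derivation3D[OF derivation3_partial(2)] derivation3D[OF derivation3_partial(3)])
    moreover have "cls p q r (const3 c) \<in> scalars p q r" by (simp add: scalars_def)
    ultimately show ?case
      using linear_maps_zero[OF A3.module_axioms W.module_axioms to_Omega_linear] by (simp add: d(4))
  next
    case (add g h)
    then show ?case
      by (simp add: \<open>\<And>g h. cls_vec p q r (grad (g + h)) = _\<close> to_Omega_hom cls_vec_closed cls_hom(1) d cls_in_carrier)
  next
    case (mult g h)
    then show ?case
      by (simp add: \<open>\<And>g h. cls_vec p q r (grad (g * h)) = _\<close> to_Omega_hom cls_vec_closed cls_hom(2) d cls_in_carrier)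
  qed (simp_all add: vars)
qed

text \<open>
  The chain rule for \<open>f\<close>, whose class is the scalar zero.
\<close>

lemma to_Omega_dF:
  "to_Omega p q r (dF p q r) = \<zero>\<^bsub>kaehler (scalars p q r) (coord_ring p q r)\<^esub>"
proof -
  have "cls p q r (f_poly p q r) = cls p q r (const3 0)"
    by (simp add: cls_eq_iff const3_hom)
  then have "cls p q r (f_poly p q r) \<in> scalars p q r"
    unfolding scalars_def by (rule range_eqI)
  then show ?thesis
    unfolding dF_eq to_Omega_grad
    by (rule derivation_intoD(4)[OF kaehler_d_derivation[OF coord_ring_cring scalars_subset]])
qed

lemma to_Omega_add_dF:
  fixes v :: "nat \<Rightarrow> 'k::field_char_0 poly3 set"
  assumes v: "v \<in> carrier (A3 p q r)"
  shows "to_Omega p q r (v \<oplus>\<^bsub>A3 p q r\<^esub> cls p q r a \<odot>\<^bsub>A3 p q r\<^esub> dF p q r) = to_Omega p q r v"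
proof -
  interpret A3: module "coord_ring p q r" "A3 p q r :: (_, nat \<Rightarrow> 'k poly3 set) module"
    by (rule A3_module)
  interpret W: module "coord_ring p q r"
    "kaehler (scalars p q r) (coord_ring p q r) :: ('k poly3 set, _) module"
    by (rule kaehler_module[OF coord_ring_cring scalars_subset])
  have dF: "dF p q r \<in> carrier (A3 p q r)" unfolding dF_eq by (rule cls_vec_closed)
  show ?thesis
    unfolding to_Omega_hom(2)[OF v A3.smult_closed[OF cls_in_carrier dF]]
      to_Omega_hom(3)[OF dF cls_in_carrier] to_Omega_dF
    by (simp add: to_Omega_hom(1)[OF v] cls_in_carrier)
qed

lemma to_Omega_projection:
  "to_Omega p q r (cls_vec p q r (euler_projection p q r g)) = to_Omega p q r (cls_vec p q r g)"
proof -
  have "cls_vec p q r g = cls_vec p q r (euler_projection p q r g) \<oplus>\<^bsub>A3 p q r\<^esub>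
      cls p q r (euler_pairing p q r g) \<odot>\<^bsub>A3 p q r\<^esub> dF p q r"
    unfolding dF_eq cls_vec_simps by (simp add: euler_projection_def)
  then show ?thesis using to_Omega_add_dF[OF cls_vec_closed] by metis
qed

text \<open>
  A derivation into a free module is a tuple of derivations into the ring.
\<close>

lemma derivation_into_A3:
  fixes D :: "nat \<Rightarrow> 'k::field_char_0 poly3 \<Rightarrow> 'k poly3"
  assumes "\<And>j. j \<in> {0, 1, 2} \<Longrightarrow> derivation3 (D j)"
    and "\<And>j. j \<in> {0, 1, 2} \<Longrightarrow> f_poly p q r dvd D j (f_poly p q r)"
  obtains d where "derivation_into (scalars p q r) (coord_ring p q r) (A3 p q r) d"
    and "\<And>g. d (cls p q r g) = cls_vec p q r (\<lambda>j. D j g)"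
proof -
  define d where "d a = (\<lambda>j\<in>{0, 1, 2}. descend p q r (D j) a)" for a
  have d: "d (cls p q r g) = cls_vec p q r (\<lambda>j. D j g)" for g
    unfolding d_def cls_vec_def by (rule restrict_ext) (simp add: descend_derivation assms)
  have "derivation_into (scalars p q r) (coord_ring p q r) (A3 p q r) d"
    unfolding derivation_into_def
  proof (intro conjI ballI)
    fix a :: "'k poly3 set" assume "a \<in> carrier (coord_ring p q r)"
    then obtain g where a: "a = cls p q r g" by (rule coord_ring_cases)
    show "d a \<in> carrier (A3 p q r)" unfolding a d by (rule cls_vec_closed)
    fix b :: "'k poly3 set" assume "b \<in> carrier (coord_ring p q r)"
    then obtain h where b: "b = cls p q r h" by (rule coord_ring_cases)
    show "d (a \<oplus>\<^bsub>coord_ring p q r\<^esub> b) = d a \<oplus>\<^bsub>A3 p q r\<^esub> d b"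
      unfolding a b d cls_hom(1)[symmetric] cls_vec_simps
      by (rule cls_vec_eqI) (simp add: derivation3D[OF assms(1)])
    show "d (a \<otimes>\<^bsub>coord_ring p q r\<^esub> b) = a \<odot>\<^bsub>A3 p q r\<^esub> d b \<oplus>\<^bsub>A3 p q r\<^esub> b \<odot>\<^bsub>A3 p q r\<^esub> d a"
      unfolding a b d cls_hom(2)[symmetric] cls_vec_simps
      by (rule cls_vec_eqI) (simp add: derivation3D[OF assms(1)])
  next
    fix c :: "'k poly3 set" assume "c \<in> scalars p q r"
    then obtain k where c: "c = cls p q r (const3 k)" unfolding scalars_def by blast
    show "d c = \<zero>\<^bsub>A3 p q r\<^esub>"
      unfolding c d cls_vec_simps by (rule cls_vec_eqI) (simp add: derivation3D[OF assms(1)])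
  qed
  then show ?thesis using d by (rule that)
qed

text \<open>
  The map \<open>A\<^sup>3 \<rightarrow> \<Omega>\<close> splits, so \<open>\<Omega>\<close> is projective. The section \<open>\<psi>\<close> comes from the derivation
  \<open>g \<mapsto> M grad g\<close>, which is well defined on the surface because \<open>M\<close> annihilates \<open>grad f\<close> modulo \<open>f\<close>.
  It is a section by the chain rule, and \<open>\<psi> \<circ> \<phi>\<close> is \<open>M\<close> because \<open>M grad x\<close>, \<open>M grad y\<close>, \<open>M grad z\<close>
  are the columns of \<open>M\<close>.
\<close>

lemma Omega_retract:
  fixes p q r :: nat
  defines "A \<equiv> (coord_ring p q r :: 'k::field_char_0 poly3 set ring)"
  defines "\<Omega> \<equiv> kaehler (scalars p q r) A"
  assumes "p \<ge> 1" "q \<ge> 1" "r \<ge> 1"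
  obtains \<psi> where "\<psi> \<in> linear_maps A \<Omega> (A3 p q r)"
    and "\<And>w. w \<in> carrier \<Omega> \<Longrightarrow> to_Omega p q r (\<psi> w) = w"
    and "\<And>g. \<psi> (to_Omega p q r (cls_vec p q r g)) = cls_vec p q r (euler_projection p q r g)"
proof -
  let ?d = "\<lambda>g :: 'k poly3. kaehler_d (scalars p q r) A (cls p q r g)"
  have \<Omega>: "module A \<Omega>"
    unfolding \<Omega>_def A_def by (rule kaehler_module[OF coord_ring_cring scalars_subset])
  have A3: "module A (A3 p q r)" unfolding A_def by (rule A3_module)
  interpret A3: module A "A3 p q r" by (rule A3)
  interpret W: module A \<Omega> by (rule \<Omega>)
  have cls: "cls p q r g \<in> carrier A" for g unfolding A_def by (rule cls_in_carrier)
  have d: "?d g \<in> carrier \<Omega>" for g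
    unfolding \<Omega>_def A_def
    by (rule derivation_intoD(1)[OF kaehler_d_derivation[OF coord_ring_cring scalars_subset] cls_in_carrier])
  \<comment> \<open>The gradient of \<open>f\<close> is the multiple of \<open>dF\<close> with coefficient one.\<close>
  have f: "f_poly p q r dvd euler_projection p q r (grad (f_poly p q r :: 'k poly3)) j" for j
    using projection_multiple_grad_f[OF assms(3-5), of "1 :: 'k poly3" j] by simp
  obtain \<delta> where \<delta>: "derivation_into (scalars p q r) A (A3 p q r) \<delta>"
      "\<And>g. \<delta> (cls p q r g) = cls_vec p q r (euler_projection p q r (grad g))"
    using derivation_into_A3[of "\<lambda>j g. euler_projection p q r (grad g) j" p q r, OF derivation3_projection_grad f]
    unfolding A_def by metis
  obtain \<psi> where \<psi>: "\<psi> \<in> linear_maps A \<Omega> (A3 p q r)"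
      "\<And>a. a \<in> carrier A \<Longrightarrow> \<psi> (kaehler_d (scalars p q r) A a) = \<delta> a"
    using kaehler_universal[OF coord_ring_cring scalars_subset A3_module \<delta>(1)[unfolded A_def]]
    unfolding \<Omega>_def A_def by metis
  have \<psi>d: "\<psi> (?d g) = cls_vec p q r (euler_projection p q r (grad g))" for g
    by (simp add: \<psi>(2) cls \<delta>(2))
  define \<phi> where "\<phi> = restrict (to_Omega p q r) (carrier (A3 p q r :: (_, nat \<Rightarrow> 'k poly3 set) module))"
  have \<phi>: "\<phi> \<in> linear_maps A (A3 p q r) \<Omega>"
    unfolding \<phi>_def \<Omega>_def A_def by (rule to_Omega_linear)
  have "(\<lambda>w\<in>carrier \<Omega>. \<phi> (\<psi> w)) = (\<lambda>w\<in>carrier \<Omega>. w)"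
  proof (rule kaehler_linear_eqI[OF coord_ring_cring scalars_subset])
    show "module (coord_ring p q r) \<Omega>" using \<Omega> unfolding A_def .
    show "(\<lambda>w\<in>carrier \<Omega>. \<phi> (\<psi> w)) \<in>
        linear_maps (coord_ring p q r) (kaehler (scalars p q r) (coord_ring p q r)) \<Omega>"
      using linear_maps_compose[OF \<Omega> \<psi>(1) \<phi>] unfolding \<Omega>_def A_def .
    show "(\<lambda>w\<in>carrier \<Omega>. w) \<in>
        linear_maps (coord_ring p q r) (kaehler (scalars p q r) (coord_ring p q r)) \<Omega>"
      using identity_linear[OF \<Omega>] unfolding \<Omega>_def A_def .
    fix a :: "'k poly3 set" assume "a \<in> carrier (coord_ring p q r)"
    then obtain g where "a = cls p q r g" by (rule coord_ring_cases)
    then have "kaehler_d (scalars p q r) (coord_ring p q r) a = ?d g" by (simp add: A_def)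
    moreover have "\<phi> (\<psi> (?d g)) = ?d g"
      unfolding \<psi>d \<phi>_def by (simp add: cls_vec_closed to_Omega_projection to_Omega_grad A_def)
    ultimately show "(\<lambda>w\<in>carrier \<Omega>. \<phi> (\<psi> w)) (kaehler_d (scalars p q r) (coord_ring p q r) a) =
        (\<lambda>w\<in>carrier \<Omega>. w) (kaehler_d (scalars p q r) (coord_ring p q r) a)"
      by (simp add: d)
  qed
  note retract_eq = fun_cong[OF this]
  have retract: "to_Omega p q r (\<psi> w) = w" if "w \<in> carrier \<Omega>" for w
    using retract_eq[of w] that linear_mapsD(1)[OF \<psi>(1) that] by (simp add: \<phi>_def)
  have "\<psi> (to_Omega p q r (cls_vec p q r g)) = cls_vec p q r (euler_projection p q r g)" for g
  proof -
    have "to_Omega p q r (cls_vec p q r g) = cls p q r (g 0) \<odot>\<^bsub>\<Omega>\<^esub> ?d var_x \<oplus>\<^bsub>\<Omega>\<^esub>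
        (cls p q r (g 1) \<odot>\<^bsub>\<Omega>\<^esub> ?d var_y \<oplus>\<^bsub>\<Omega>\<^esub> cls p q r (g 2) \<odot>\<^bsub>\<Omega>\<^esub> ?d var_z)"
      unfolding to_Omega_eq[OF cls_vec_closed] \<Omega>_def A_def by (simp add: cls_vec_def)
    then have "\<psi> (to_Omega p q r (cls_vec p q r g)) =
        cls p q r (g 0) \<odot>\<^bsub>A3 p q r\<^esub> cls_vec p q r (euler_projection p q r (grad var_x)) \<oplus>\<^bsub>A3 p q r\<^esub>
        (cls p q r (g 1) \<odot>\<^bsub>A3 p q r\<^esub> cls_vec p q r (euler_projection p q r (grad var_y)) \<oplus>\<^bsub>A3 p q r\<^esub>
         cls p q r (g 2) \<odot>\<^bsub>A3 p q r\<^esub> cls_vec p q r (euler_projection p q r (grad var_z)))"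
      by (simp add: linear_mapsD[OF \<psi>(1)] \<psi>d cls d)
    also have "\<dots> = cls_vec p q r (euler_projection p q r g)"
      unfolding cls_vec_simps
      by (rule cls_vec_eqI)
        (auto simp: euler_projection_def euler_pairing_def grad_def[of var_x] grad_def[of var_y]
          grad_def[of var_z] partial_vars algebra_simps)
    finally show ?thesis .
  qed
  with \<psi>(1) retract show ?thesis by (rule that)
qed

text \<open>
  The connection is \<open>\<phi> \<circ> \<delta> \<circ> \<psi>\<close>. On \<open>\<phi> v\<close> it gives \<open>\<phi> (\<delta> (M v))\<close>, which the identity for \<open>\<delta>(M v)\<close>
  turns into the image of \<open>\<delta> v + \<delta>(M) v\<close>, because \<open>\<phi>\<close> annihilates \<open>dF\<close>.
\<close>

theorem theorem3p4:
  fixes p q r :: nat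
    and A :: "'k::field_char_0 poly3 set ring"
    and K :: "'k poly3 set set"
    and \<Omega> :: "('k poly3 set, ('k poly3 set \<Rightarrow> 'k poly3 set) set) module"
  assumes "p \<ge> 2" and "q \<ge> 2" and "r \<ge> 2"
    and "A = coord_ring p q r"
    and "K = scalars p q r"
    and "\<Omega> = kaehler K A"
  shows "(\<forall>\<delta>\<in>der_gens p q r. \<forall>v\<in>(A_dF p q r :: (nat \<Rightarrow> 'k poly3 set) set).
            conn_op p q r \<delta> v \<in> A_dF p q r) \<and>
         (\<exists>nabla\<in>connections K A \<Omega>. \<forall>\<delta>\<in>der_gens p q r. \<forall>v\<in>carrier (A3 p q r).
            nabla \<delta> (to_Omega p q r v) = to_Omega p q r (conn_op p q r \<delta> v))"
proof (intro conjI ballI)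
  have pqr: "p \<ge> 1" "q \<ge> 1" "r \<ge> 1" using assms(1-3) by simp_all
  fix \<delta> :: "'k poly3 set \<Rightarrow> 'k poly3 set" and v :: "nat \<Rightarrow> 'k poly3 set"
  assume "\<delta> \<in> der_gens p q r" "v \<in> A_dF p q r"
  then show "conn_op p q r \<delta> v \<in> A_dF p q r"
    by (elim der_gens_cases) (simp only: conn_op_preserves_A_dF[OF pqr])
next
  have pqr: "p \<ge> 1" "q \<ge> 1" "r \<ge> 1" using assms(1-3) by simp_all
  have A: "cring A" and K: "K \<subseteq> carrier A"
    unfolding assms(4,5) by (rule coord_ring_cring scalars_subset)+
  have \<Omega>: "module A \<Omega>" unfolding assms(6) by (rule kaehler_module[OF A K])
  obtain \<psi> where \<psi>: "\<psi> \<in> linear_maps A \<Omega> (A3 p q r)"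
    and retract: "\<And>w. w \<in> carrier \<Omega> \<Longrightarrow> to_Omega p q r (\<psi> w) = w"
    and proj: "\<And>g. \<psi> (to_Omega p q r (cls_vec p q r g)) = cls_vec p q r (euler_projection p q r g)"
    using Omega_retract[OF pqr] unfolding assms(4-6) by metis
  define \<phi> where "\<phi> = restrict (to_Omega p q r) (carrier (A3 p q r :: (_, nat \<Rightarrow> 'k poly3 set) module))"
  have \<phi>: "\<phi> \<in> linear_maps A (A3 p q r) \<Omega>"
    unfolding \<phi>_def assms(4-6) by (rule to_Omega_linear)
  define nabla where
    "nabla = (\<lambda>\<delta>\<in>carrier (Der K A). \<lambda>w\<in>carrier \<Omega>. \<phi> (entrywise {0, 1, 2} \<delta> (\<psi> w)))"
  have A3: "A3 p q r = free_module A {0, 1, 2}" by (simp add: A3_def assms(4))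
  have "nabla \<in> connections K A \<Omega>"
    unfolding nabla_def
  proof (rule connection_of_retract[OF A K \<Omega>])
    show "\<phi> (\<psi> w) = w" if "w \<in> carrier \<Omega>" for w
      using retract[OF that] linear_mapsD(1)[OF \<psi> that] by (simp add: \<phi>_def)
  qed (use \<phi> \<psi> A3 in simp_all)
  moreover have "nabla \<delta> (to_Omega p q r v) = to_Omega p q r (conn_op p q r \<delta> v)"
    if \<delta>: "\<delta> \<in> der_gens p q r" and v: "v \<in> carrier (A3 p q r)" for \<delta> v
  proof -
    obtain D where D: "derivation3 D" "f_poly p q r dvd D (f_poly p q r)" "\<delta> = descend p q r D"
      using \<delta> by (rule der_gens_cases)
    obtain g where g: "v = cls_vec p q r g" using v by (rule A3_cases)
    have "\<delta> \<in> carrier (Der K A)" unfolding D(3) assms(4,5) by (rule descend_derivation(2)[OF D(1,2)])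
    moreover have "to_Omega p q r v \<in> carrier \<Omega>" unfolding assms(4-6) by (rule to_Omega_hom(1)[OF v])
    ultimately have "nabla \<delta> (to_Omega p q r v) =
        \<phi> (entrywise {0, 1, 2} \<delta> (cls_vec p q r (euler_projection p q r g)))"
      by (simp add: nabla_def g proj)
    also have "\<dots> = to_Omega p q r (entrywise {0, 1, 2} \<delta> (cls_vec p q r (euler_projection p q r g)))"
      unfolding D(3) entrywise_cls_vec[OF D(1,2)] \<phi>_def by (simp add: cls_vec_closed)
    also have "\<dots> = to_Omega p q r (conn_op p q r \<delta> v)"
      unfolding D(3) g conn_op_cls_vec[OF pqr D(1,2)]
      by (rule to_Omega_add_dF[symmetric]) (simp only: entrywise_cls_vec[OF D(1,2)] cls_vec_closed)
    finally show ?thesis .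
  qed
  ultimately show "\<exists>nabla\<in>connections K A \<Omega>. \<forall>\<delta>\<in>der_gens p q r. \<forall>v\<in>carrier (A3 p q r).
      nabla \<delta> (to_Omega p q r v) = to_Omega p q r (conn_op p q r \<delta> v)"
    by blast
qed

end
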